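(* Consider the centralized selection model described in the context. Let $\eta_1,\eta_2,\eta_3>0$ be such that $|G_j|\ge \eta_1 n$ for each $j\in\{1,2\}$, $K\ge \eta_2 n$, and $k_\ell\ge \eta_3 K$ for each $\ell\in[p]$. Then for any distribution $\mathcal D$ of latent utilities, any distribution $\mathcal L$ of preference lists, and any bias parameter $\beta\in(0,1]$, the algorithm $\mathcal A_{\rm inst\text{-}wise}$ satisfies $$\mathscr{P}(\mathcal{A}_{\rm inst\text{-}wise}) \ge 1 - O\!\left(\frac{p\sqrt{\log K}}{\eta_1\eta_3\sqrt{K}}\right),\qquad \mathscr{U}(\mathcal{A}_{\rm inst\text{-}wise}) \ge 1 - O\!\left(\frac{\sqrt{\log n}}{\sqrt{\eta_2 n}}\right),\qquad \mathscr{R}(\mathcal{A}_{\rm inst\text{-}wise})=1.$$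
   Context: Model: there are $n$ candidates and $p$ institutions; institution $\ell\in[p]$ has capacity $k_\ell\in\mathbb{Z}_{\ge0}$ and $K=\sum_{\ell} k_\ell\le n$. The candidates are partitioned into groups $G_1$ and $G_2$, with $n_j=|G_j|$. Each candidate $i$ has a latent utility $u_i\ge 0$ (drawn i.i.d. from a distribution $\mathcal D$) and a preference list $\sigma_i$, a ranking of $[p]$ (drawn i.i.d. from a distribution $\mathcal L$, independently of utilities). For a bias parameter $\beta\in(0,1]$ the estimated utilities are $\hat u_i=u_i$ for $i\in G_1$ and $\hat u_i=\beta u_i$ for $i\in G_2$. An assignment is a partial function $M:[n]\to[p]$ with $|M^{-1}(\ell)|\le k_\ell$. Algorithm $\mathcal A_{\rm st}$ on a set of candidates with given capacities: consider candidates in decreasing order of $\hat u_i$ and assign each to its most preferred institution that still has a vacant slot, until all slots are full. Algorithm $\mathcal A_{\rm inst\text{-}wise}$: for each $j\in\{1,2\}$ run $\mathcal A_{\rm st}$ on the candidates of $G_j$ only, with the capacity of institution $\ell$ set to $k_\ell\cdot n_j/n$ (these quantities assumed to be integers), and output the union of the two assignments. Metrics for an algorithm $\mathcal A$ outputting $M$ from $(\hat u,\sigma)$, with expectations over $u\sim\mathcal D^n,\sigma\sim\mathcal L^n$: $\mathscr U(\mathcal A)=\mathbb E\big[\sum_{i\in M^{-1}([p])}u_i/\mathsf U^\star(u)\big]$ with $\mathsf U^\star(u)$ the sum of the $K$ largest latent utilities; $\mathscr R(\mathcal A)=\mathbb E[\min_j\rho_j/\max_j\rho_j]$, $\rho_j$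 the fraction of $G_j$ assigned to some institution; $\mathscr P(\mathcal A)=\mathbb E[\min_j\pi_j/\max_j\pi_j]$, $\pi_j$ the fraction of $G_j$ assigned to their first-ranked institution. *)

theory Defs
  imports "HOL-Probability.Probability" "HOL-Combinatorics.Multiset_Permutations"
begin

text \<open>
  Candidates are the numbers below \<open>n\<close>, institutions the numbers below \<open>p\<close>.  A preference list is
  a list enumerating the institutions without repetition, most preferred first.  An assignment
  \<open>M\<close> is a partial function, and \<open>M i = None\<close> means that \<open>i\<close> is not selected.
\<close>

locale selection_model =
  fixes n p :: nat
    and k :: "nat \<Rightarrow> nat"
    and G\<^sub>1 G\<^sub>2 :: "nat set"
    and D :: "real measure"
    and L :: "nat list pmf"
    and \<beta> :: real
  assumes n_pos: "0 < n"
    and total_capacity: "(\<Sum>l<p. k l) \<le> n"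
    and groups_cover: "G\<^sub>1 \<union> G\<^sub>2 = {..<n}"
    and groups_disjoint: "G\<^sub>1 \<inter> G\<^sub>2 = {}"
    and prob_utilities: "prob_space D"
    and borel_utilities: "sets D = sets borel"
    and nonneg_utilities: "AE x in D. 0 \<le> x"
    and rankings: "set_pmf L \<subseteq> permutations_of_set {..<p}"
    and bias: "0 < \<beta>" "\<beta> \<le> 1"

definition estimated_utility :: "real \<Rightarrow> nat set \<Rightarrow> (nat \<Rightarrow> real) \<Rightarrow> nat \<Rightarrow> real" where
  "estimated_utility \<beta> G\<^sub>2 u i = (if i \<in> G\<^sub>2 then \<beta> * u i else u i)"

text \<open>
  Since \<^const>\<open>sort_key\<close> is stable, candidates with equal estimated utility are considered in the
  order of their indices.
\<close>

definition candidate_order :: "nat set \<Rightarrow> (nat \<Rightarrow> real) \<Rightarrow> nat list" where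
  "candidate_order S v = sort_key (\<lambda>i. - v i) (sorted_list_of_set S)"

text \<open>
  The search below returns \<^const>\<open>None\<close> exactly when no listed institution has a vacant slot, so
  candidates considered after all slots are full stay unassigned.
\<close>

definition assign_next ::
  "(nat \<Rightarrow> nat) \<Rightarrow> (nat \<Rightarrow> nat list) \<Rightarrow> nat \<Rightarrow> (nat \<rightharpoonup> nat) \<Rightarrow> (nat \<rightharpoonup> nat)" where
  "assign_next c \<sigma> i M = M(i := List.find (\<lambda>l. card {j. M j = Some l} < c l) (\<sigma> i))"

definition alg_st ::
  "nat set \<Rightarrow> (nat \<Rightarrow> nat) \<Rightarrow> (nat \<Rightarrow> real) \<Rightarrow> (nat \<Rightarrow> nat list) \<Rightarrow> (nat \<rightharpoonup> nat)" where
  "alg_st S c v \<sigma> = fold (assign_next c \<sigma>) (candidate_order S v) Map.empty"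

text \<open>
  Natural-number division is used for the group capacities; it is exact under the integrality
  assumption \<open>n dvd k l * card G\<close>.
\<close>

definition alg_inst_wise ::
  "nat \<Rightarrow> (nat \<Rightarrow> nat) \<Rightarrow> nat set \<Rightarrow> nat set \<Rightarrow> (nat \<Rightarrow> real) \<Rightarrow> (nat \<Rightarrow> nat list) \<Rightarrow> (nat \<rightharpoonup> nat)"
where
  "alg_inst_wise n k G\<^sub>1 G\<^sub>2 v \<sigma> =
     alg_st G\<^sub>1 (\<lambda>l. k l * card G\<^sub>1 div n) v \<sigma> ++ alg_st G\<^sub>2 (\<lambda>l. k l * card G\<^sub>2 div n) v \<sigma>"

definition population ::
  "nat \<Rightarrow> real measure \<Rightarrow> nat list pmf \<Rightarrow> ((nat \<Rightarrow> real) \<times> (nat \<Rightarrow> nat list)) measure" where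
  "population n D L = PiM {..<n} (\<lambda>_. D) \<Otimes>\<^sub>M PiM {..<n} (\<lambda>_. measure_pmf L)"

definition assigned :: "nat \<Rightarrow> (nat \<rightharpoonup> nat) \<Rightarrow> nat set" where
  "assigned p M = M -` (Some ` {..<p})"

definition optimal_utility :: "nat \<Rightarrow> nat \<Rightarrow> (nat \<Rightarrow> real) \<Rightarrow> real" where
  "optimal_utility n K u = sum_list (take K (rev (sort (map u [0..<n]))))"

text \<open>
  If the optimal utility is 0 then every selection attains it, and the ratio is taken to be 1.  This
  event can have positive probability, namely when the utility distribution has an atom at 0.
\<close>

definition utility_ratio ::
  "nat \<Rightarrow> nat \<Rightarrow> nat \<Rightarrow> (nat \<Rightarrow> real) \<Rightarrow> (nat \<rightharpoonup> nat) \<Rightarrow> real" where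
  "utility_ratio n p K u M =
     (if optimal_utility n K u = 0 then 1
      else (\<Sum>i\<in>assigned p M. u i) / optimal_utility n K u)"

definition assigned_fraction :: "nat \<Rightarrow> (nat \<rightharpoonup> nat) \<Rightarrow> nat set \<Rightarrow> real" where
  "assigned_fraction p M G = real (card (G \<inter> assigned p M)) / real (card G)"

definition first_choice_fraction ::
  "(nat \<Rightarrow> nat list) \<Rightarrow> (nat \<rightharpoonup> nat) \<Rightarrow> nat set \<Rightarrow> real" where
  "first_choice_fraction \<sigma> M G = real (card {i \<in> G. M i = Some (hd (\<sigma> i))}) / real (card G)"

definition min_max_ratio :: "real \<Rightarrow> real \<Rightarrow> real" where
  "min_max_ratio x y = min x y / max x y"

text \<open>
  An algorithm \<open>A\<close> receives the estimated utilities and the preference lists.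
\<close>

definition utility_metric ::
  "nat \<Rightarrow> nat \<Rightarrow> nat \<Rightarrow> nat set \<Rightarrow> real measure \<Rightarrow> nat list pmf \<Rightarrow> real \<Rightarrow>
   ((nat \<Rightarrow> real) \<Rightarrow> (nat \<Rightarrow> nat list) \<Rightarrow> (nat \<rightharpoonup> nat)) \<Rightarrow> real" where
  "utility_metric n p K G\<^sub>2 D L \<beta> A =
     (\<integral>(u, \<sigma>). utility_ratio n p K u (A (estimated_utility \<beta> G\<^sub>2 u) \<sigma>) \<partial>population n D L)"

definition representation_metric ::
  "nat \<Rightarrow> nat \<Rightarrow> nat set \<Rightarrow> nat set \<Rightarrow> real measure \<Rightarrow> nat list pmf \<Rightarrow> real \<Rightarrow>
   ((nat \<Rightarrow> real) \<Rightarrow> (nat \<Rightarrow> nat list) \<Rightarrow> (nat \<rightharpoonup> nat)) \<Rightarrow> real" where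
  "representation_metric n p G\<^sub>1 G\<^sub>2 D L \<beta> A =
     (\<integral>(u, \<sigma>). (let M = A (estimated_utility \<beta> G\<^sub>2 u) \<sigma>
        in min_max_ratio (assigned_fraction p M G\<^sub>1) (assigned_fraction p M G\<^sub>2))
      \<partial>population n D L)"

definition preference_metric ::
  "nat \<Rightarrow> nat set \<Rightarrow> nat set \<Rightarrow> real measure \<Rightarrow> nat list pmf \<Rightarrow> real \<Rightarrow>
   ((nat \<Rightarrow> real) \<Rightarrow> (nat \<Rightarrow> nat list) \<Rightarrow> (nat \<rightharpoonup> nat)) \<Rightarrow> real" where
  "preference_metric n G\<^sub>1 G\<^sub>2 D L \<beta> A =
     (\<integral>(u, \<sigma>). (let M = A (estimated_utility \<beta> G\<^sub>2 u) \<sigma>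
        in min_max_ratio (first_choice_fraction \<sigma> M G\<^sub>1) (first_choice_fraction \<sigma> M G\<^sub>2))
      \<partial>population n D L)"

end

theory Submission
  imports Defs
begin

text \<open>
  Preference: within a group exactly the first \<open>m = K |G| / n\<close> candidates are assigned, and their
  lists are i.i.d. in order of utility.  The reference is a deterministic fluid in which every
  candidate is spread over the institutions that still have room according to \<^term>\<open>L\<close>, and
  which fills institution \<open>l\<close> at time \<open>t l\<close>.  Rescale its time to the group, once stretched down
  and once sped up by a factor \<open>1 \<plusminus> \<epsilon>\<close>.  If, with the vacant sets prescribed by the rescaled fluid, no
  institution is overfilled (respectively, all are filled), then the actual vacant sets contain
  (respectively, are contained in) the prescribed ones.  With prescribed sets all counts are sums of
  independent indicators, so Hoeffding's inequality applies, and both groups have nearly the same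
  fraction of first choices as the fluid.

  Utility: averaging over permutations of the candidates, group \<open>j\<close> receives a hypergeometric number
  \<open>X\<close> of the \<open>K\<close> best candidates, independently of their utilities, and the loss is at most
  \<open>E |X - K n\<^sub>j / n| / K \<le> 1 / sqrt K\<close>.
\<close>

section \<open>The assignment process along a sequence of preference lists\<close>

text \<open>The obstacle for preferences is feedback: whether a slot is open depends on all earlier
  lists, so the number of first choices is not a sum of independent terms. A closing schedule fixed
  in advance removes the feedback, and the greedy rule is monotone enough to be trapped between two
  such schedules. The fluid depends on \<open>L\<close> and \<open>k\<close> only. If
  \<open>F\<close> is its total of first choices, a group with the fraction \<open>\<alpha>\<close>
  of all candidates gets about \<open>\<alpha> * F\<close> of them; divided by the group size this
  is \<open>F / n\<close> for both groups, which is why the ratio is close to 1.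

  The slack \<epsilon> has order sqrt (ln K) / (\<open>\<eta>\<^sub>3\<close> sqrt
  (\<open>\<eta>\<^sub>1\<close> K)): a failure probability of 1 / K costs deviations of order sqrt
  (m ln K), and these must fit into an \<epsilon>-fraction of the smallest quota, which is at least
  \<open>\<eta>\<^sub>3 * m\<close>, where m is at least \<open>\<eta>\<^sub>1 * K\<close>. For K =
  1 the logarithm would vanish, but exact division of the slots between two nonempty groups forces K
  \<ge> 2.

  The bias drops out because inside one group all utilities are scaled by the same positive factor,
  so candidates are considered in the order of latent utility.\<close>

definition top_choice :: "'a list \<Rightarrow> 'a set \<Rightarrow> 'a option" where
  "top_choice w A = List.find (\<lambda>l. l \<in> A) w"

lemma top_choice_SomeD:
  assumes "top_choice w A = Some l"
  shows "l \<in> set w" "l \<in> A"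
  using assms unfolding top_choice_def by (auto simp: find_Some_iff in_set_conv_nth)

lemma top_choice_eq_None_iff: "top_choice w A = None \<longleftrightarrow> set w \<inter> A = {}"
  unfolding top_choice_def by (auto simp: find_None_iff)

text \<open>Independence of irrelevant alternatives: removing options other than the chosen one does
  not change the choice. Both comparisons of vacant sets rest on this.\<close>

lemma top_choice_antimono:
  assumes "top_choice w B = Some l" "l \<in> A" "A \<subseteq> B"
  shows "top_choice w A = Some l"
  using assms unfolding top_choice_def by (induction w) (auto split: if_splits)

lemma top_choice_eq_hd_iff:
  "w \<noteq> [] \<Longrightarrow> top_choice w A = Some (hd w) \<longleftrightarrow> hd w \<in> A"
  unfolding top_choice_def by (cases w) (auto simp: find_Some_iff)

lemma top_choice_Int:
  "set w \<subseteq> P \<Longrightarrow> top_choice w (A \<inter> P) = top_choice w A"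
  unfolding top_choice_def by (rule find_cong) auto

text \<open>The recursion needs the vacant set before \<open>vacant\<close> can be defined from it,
  hence the inlined comprehension; \<open>filled_Suc\<close> later takes the place of the second
  equation.\<close>

primrec filled :: "(nat \<Rightarrow> nat) \<Rightarrow> (nat \<Rightarrow> nat list) \<Rightarrow> nat \<Rightarrow> nat \<Rightarrow> nat" where
  "filled c \<omega> 0 l = 0"
| "filled c \<omega> (Suc s) l =
     filled c \<omega> s l + (if top_choice (\<omega> s) {l'. filled c \<omega> s l' < c l'} = Some l then 1 else 0)"

text \<open>Numbers that are no institutions may belong to this set; valid lists never mention them,
  and where it matters the set is intersected with the institutions.\<close>

definition vacant :: "(nat \<Rightarrow> nat) \<Rightarrow> (nat \<Rightarrow> nat list) \<Rightarrow> nat \<Rightarrow> nat set" where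
  "vacant c \<omega> s = {l. filled c \<omega> s l < c l}"

lemma filled_Suc:
  "filled c \<omega> (Suc s) l =
     filled c \<omega> s l + (if top_choice (\<omega> s) (vacant c \<omega> s) = Some l then 1 else 0)"
  by (simp add: vacant_def)

declare filled.simps(2) [simp del]

lemma filled_eq_card:
  "filled c \<omega> s l = card {r. r < s \<and> top_choice (\<omega> r) (vacant c \<omega> r) = Some l}"
proof (induction s)
  case (Suc s)
  have "{r. r < Suc s \<and> top_choice (\<omega> r) (vacant c \<omega> r) = Some l} =
      (if top_choice (\<omega> s) (vacant c \<omega> s) = Some l then insert s else id)
        {r. r < s \<and> top_choice (\<omega> r) (vacant c \<omega> r) = Some l}"
    by (auto simp: less_Suc_eq)
  with Suc show ?case
    by (simp add: filled_Suc)
qed simp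

lemma filled_le: "filled c \<omega> s l \<le> c l"
proof (induction s)
  case (Suc s)
  show ?case
  proof (cases "top_choice (\<omega> s) (vacant c \<omega> s) = Some l")
    case True
    from top_choice_SomeD(2)[OF this] show ?thesis
      by (simp add: filled_Suc vacant_def)
  qed (use Suc in \<open>simp add: filled_Suc\<close>)
qed simp

lemma vacant_antimono: "r \<le> s \<Longrightarrow> vacant c \<omega> s \<subseteq> vacant c \<omega> r"
proof (induction s rule: dec_induct)
  case (step s)
  have "filled c \<omega> s l \<le> filled c \<omega> (Suc s) l" for l
    by (simp add: filled_Suc)
  then have "vacant c \<omega> (Suc s) \<subseteq> vacant c \<omega> s"
    by (auto simp: vacant_def intro: le_less_trans)
  with step.IH show ?case by blast
qed simp

text \<open>Causality: the state before step \<open>s\<close> sees earlier lists only, so a sequence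
  may be cut off after the steps of interest.\<close>

lemma filled_cong:
  assumes "\<And>r. r < s \<Longrightarrow> \<omega> r = \<omega>' r"
  shows "filled c \<omega> s = filled c \<omega>' s"
  using assms
proof (induction s)
  case (Suc s)
  then have "filled c \<omega> s = filled c \<omega>' s" "\<omega> s = \<omega>' s" by auto
  then show ?case by (intro ext) (simp add: filled_Suc vacant_def)
qed (simp add: fun_eq_iff)

lemma vacant_cong:
  assumes "\<And>r. r < s \<Longrightarrow> \<omega> r = \<omega>' r"
  shows "vacant c \<omega> s = vacant c \<omega>' s"
  using filled_cong[OF assms] by (simp add: vacant_def)

text \<open>A complete list finds a slot whenever one is vacant, so each step consumes exactly one
  slot until none is left.\<close>

lemma sum_filled:
  assumes "\<And>r. r < s \<Longrightarrow> set (\<omega> r) = {..<p}"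
  shows "(\<Sum>l<p. filled c \<omega> s l) = min s (\<Sum>l<p. c l)"
  using assms
proof (induction s)
  case (Suc s)
  then have IH: "(\<Sum>l<p. filled c \<omega> s l) = min s (\<Sum>l<p. c l)" and w: "set (\<omega> s) = {..<p}"
    by auto
  have step: "(\<Sum>l<p. filled c \<omega> (Suc s) l) = (\<Sum>l<p. filled c \<omega> s l) +
      (\<Sum>l<p. if top_choice (\<omega> s) (vacant c \<omega> s) = Some l then 1 else 0)"
    by (simp add: filled_Suc sum.distrib)
  show ?case
  proof (cases "top_choice (\<omega> s) (vacant c \<omega> s)")
    case None
    then have "{..<p} \<inter> vacant c \<omega> s = {}"
      unfolding top_choice_eq_None_iff w .
    then have "filled c \<omega> s l = c l" if "l < p" for l
    proof -
      from that \<open>{..<p} \<inter> vacant c \<omega> s = {}\<close> have "l \<notin> vacant c \<omega> s" by blast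
      with filled_le[of c \<omega> s l] show ?thesis by (simp add: vacant_def)
    qed
    then have "(\<Sum>l<p. filled c \<omega> s l) = (\<Sum>l<p. c l)"
      by simp
    with IH step None show ?thesis by simp
  next
    case (Some l)
    with top_choice_SomeD[OF Some] w have l: "l < p" "filled c \<omega> s l < c l"
      by (auto simp: vacant_def)
    have "(\<Sum>l<p. filled c \<omega> s l) < (\<Sum>l<p. c l)"
      using l by (intro sum_strict_mono_ex1 ballI filled_le) auto
    with IH step Some l show ?thesis by simp
  qed
qed simp

lemma top_choice_vacant_ne_None:
  assumes "\<And>r. r \<le> s \<Longrightarrow> set (\<omega> r) = {..<p}"
  shows "top_choice (\<omega> s) (vacant c \<omega> s) \<noteq> None \<longleftrightarrow> s < (\<Sum>l<p. c l)"
proof -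
  have sum: "(\<Sum>l<p. filled c \<omega> s l) = min s (\<Sum>l<p. c l)"
    using assms by (intro sum_filled) auto
  have "top_choice (\<omega> s) (vacant c \<omega> s) \<noteq> None \<longleftrightarrow> (\<exists>l<p. filled c \<omega> s l < c l)"
    using assms[of s] by (auto simp: top_choice_eq_None_iff vacant_def)
  also have "\<dots> \<longleftrightarrow> (\<Sum>l<p. filled c \<omega> s l) < (\<Sum>l<p. c l)"
  proof
    assume "\<exists>l<p. filled c \<omega> s l < c l"
    then show "(\<Sum>l<p. filled c \<omega> s l) < (\<Sum>l<p. c l)"
      by (intro sum_strict_mono_ex1 ballI filled_le) auto
  next
    assume "(\<Sum>l<p. filled c \<omega> s l) < (\<Sum>l<p. c l)"
    then show "\<exists>l<p. filled c \<omega> s l < c l"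
      by (metis lessThan_iff not_le sum_mono)
  qed
  finally show ?thesis using sum by auto
qed

section \<open>Comparison of the true vacant sets with a prescribed decreasing family\<close>

text \<open>As long as the prescribed sets are contained in the true ones, whoever truly takes an
  institution \<open>l\<close> still prescribed as open would also take it from the smaller
  prescribed set. So \<open>l\<close> has received at most its prescribed count, is not full, and
  the inclusion persists.\<close>

lemma vacant_superset:
  assumes "\<And>r s. r \<le> s \<Longrightarrow> B s \<subseteq> B r"
    and "\<And>l. l \<in> B 0 \<Longrightarrow> card {r. r < m \<and> top_choice (\<omega> r) (B r) = Some l} < c l"
    and "s < m"
  shows "B s \<subseteq> vacant c \<omega> s"
  using \<open>s < m\<close>
proof (induction s rule: less_induct)
  case (less s)
  show ?case
  proof
    fix l assume l: "l \<in> B s"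
    have "top_choice (\<omega> r) (B r) = Some l"
      if "r < s" "top_choice (\<omega> r) (vacant c \<omega> r) = Some l" for r
      using top_choice_antimono[OF that(2), of "B r"] l assms(1)[of r s] less that(1) by auto
    then have "filled c \<omega> s l \<le> card {r. r < m \<and> top_choice (\<omega> r) (B r) = Some l}"
      unfolding filled_eq_card using less.prems by (intro card_mono) auto
    also have "\<dots> < c l"
      using l assms(1)[of 0 s] by (intro assms(2)) auto
    finally show "l \<in> vacant c \<omega> s" by (simp add: vacant_def)
  qed
qed

text \<open>Dual to the previous argument. If \<open>l\<close> were still vacant after its
  prescribed closing, then everyone choosing it under the prescription came earlier and, the true
  sets being smaller and containing \<open>l\<close>, really took it; this already fills
  \<open>l\<close>. An institution that is never closed before \<open>m\<close> needs no
  count.\<close>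

lemma vacant_subset:
  assumes "\<And>r s. r \<le> s \<Longrightarrow> B s \<subseteq> B r"
    and "\<And>r. r < m \<Longrightarrow> set (\<omega> r) \<subseteq> P"
    and "\<And>l. l \<in> P \<Longrightarrow> (\<forall>s<m. l \<in> B s) \<or> c l \<le> card {r. r < m \<and> top_choice (\<omega> r) (B r) = Some l}"
    and "s < m"
  shows "vacant c \<omega> s \<inter> P \<subseteq> B s"
  using \<open>s < m\<close>
proof (induction s rule: less_induct)
  case (less s)
  show ?case
  proof (rule ccontr)
    assume "\<not> vacant c \<omega> s \<inter> P \<subseteq> B s"
    then obtain l where l: "l \<in> vacant c \<omega> s" "l \<in> P" "l \<notin> B s" by blast
    have vac: "l \<in> vacant c \<omega> r" if "r \<le> s" for r
      using l(1) vacant_antimono[OF that] by blast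
    have "r < s \<and> top_choice (\<omega> r) (vacant c \<omega> r) = Some l"
      if r: "r < m" "top_choice (\<omega> r) (B r) = Some l" for r
    proof
      show "r < s"
        using top_choice_SomeD(2)[OF r(2)] l(3) assms(1)[of s r] by (cases "r < s") auto
      then have "top_choice (\<omega> r) (vacant c \<omega> r \<inter> P) = Some l"
        using less r l vac[of r] by (intro top_choice_antimono[OF r(2)]) auto
      then show "top_choice (\<omega> r) (vacant c \<omega> r) = Some l"
        by (simp add: top_choice_Int[OF assms(2)[OF r(1)]])
    qed
    then have "card {r. r < m \<and> top_choice (\<omega> r) (B r) = Some l} \<le> filled c \<omega> s l"
      unfolding filled_eq_card by (intro card_mono) auto
    also have "\<dots> < c l" using l(1) by (simp add: vacant_def)
    finally show False using assms(3)[OF l(2)] l(3) less.prems by auto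
  qed
qed

section \<open>Translation of the selection algorithm into the process\<close>

text \<open>Positions in the order of consideration become time. The second conjunct is needed in
  the induction: it guarantees that the occupants counted by \<open>assign_next\<close> are exactly
  positions already processed.\<close>

lemma fold_assign_next:
  fixes c :: "nat \<Rightarrow> nat" and \<sigma> :: "nat \<Rightarrow> nat list"
  assumes "distinct xs" "s \<le> length xs"
  defines "M \<equiv> fold (assign_next c \<sigma>) (take s xs) Map.empty"
  defines "\<omega> \<equiv> \<lambda>r. \<sigma> (xs ! r)"
  shows "(\<forall>r<s. M (xs ! r) = top_choice (\<omega> r) (vacant c \<omega> r)) \<and> (\<forall>i. i \<notin> set (take s xs) \<longrightarrow> M i = None)"
  using \<open>s \<le> length xs\<close> unfolding M_def
proof (induction s)
  case (Suc s)
  define M where "M = fold (assign_next c \<sigma>) (take s xs) Map.empty"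
  have s: "s < length xs" using Suc by simp
  have IH: "M (xs ! r) = top_choice (\<omega> r) (vacant c \<omega> r)" if "r < s" for r
    using Suc that by (auto simp: M_def)
  have IH': "M i = None" if "i \<notin> set (take s xs)" for i
    using Suc that by (auto simp: M_def)
  have "{j. M j = Some l} = (\<lambda>r. xs ! r) ` {r. r < s \<and> top_choice (\<omega> r) (vacant c \<omega> r) = Some l}" for l
  proof (intro set_eqI iffI)
    fix j assume "j \<in> {j. M j = Some l}"
    with IH'[of j] have "j \<in> set (take s xs)" by fastforce
    then obtain r where "r < s" "j = xs ! r"
      using s by (auto simp: in_set_conv_nth)
    with \<open>j \<in> {j. M j = Some l}\<close> IH[of r] show
      "j \<in> (\<lambda>r. xs ! r) ` {r. r < s \<and> top_choice (\<omega> r) (vacant c \<omega> r) = Some l}"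
      by auto
  qed (use IH in auto)
  moreover have "inj_on (\<lambda>r. xs ! r) {r. r < s \<and> top_choice (\<omega> r) (vacant c \<omega> r) = Some l}" for l
    using assms(1) s by (auto simp: inj_on_def nth_eq_iff_index_eq)
  ultimately have card: "card {j. M j = Some l} = filled c \<omega> s l" for l
    by (simp add: card_image filled_eq_card)
  have upd: "fold (assign_next c \<sigma>) (take (Suc s) xs) Map.empty =
      M(xs ! s := top_choice (\<omega> s) (vacant c \<omega> s))"
    using s by (simp add: take_Suc_conv_app_nth M_def[symmetric] assign_next_def card
        top_choice_def vacant_def \<omega>_def)
  have ne: "xs ! r \<noteq> xs ! s" if "r < s" for r
    using that s assms(1) by (simp add: nth_eq_iff_index_eq)
  show ?case
    unfolding upd using IH IH' s ne by (auto simp: less_Suc_eq take_Suc_conv_app_nth)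
qed simp

lemma set_candidate_order: "finite S \<Longrightarrow> set (candidate_order S v) = S"
  and distinct_candidate_order: "finite S \<Longrightarrow> distinct (candidate_order S v)"
  and length_candidate_order: "length (candidate_order S v) = card S"
  by (simp_all add: candidate_order_def)

lemma alg_st_nth:
  fixes c :: "nat \<Rightarrow> nat" and v :: "nat \<Rightarrow> real" and \<sigma> :: "nat \<Rightarrow> nat list"
  assumes "finite S" "s < card S"
  defines "\<omega> \<equiv> \<lambda>r. \<sigma> (candidate_order S v ! r)"
  shows "alg_st S c v \<sigma> (candidate_order S v ! s) = top_choice (\<omega> s) (vacant c \<omega> s)"
  using fold_assign_next[OF distinct_candidate_order[OF assms(1)], of "card S" v c \<sigma>] assms(2)
  by (simp add: alg_st_def \<omega>_def length_candidate_order)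

lemma alg_st_outside:
  assumes "finite S" "i \<notin> S"
  shows "alg_st S c v \<sigma> i = None"
  using fold_assign_next[OF distinct_candidate_order[OF assms(1)], of "card S" v c \<sigma>] assms
  by (simp add: alg_st_def length_candidate_order set_candidate_order)

text \<open>Lists decide where a candidate goes, but not who is selected. Hence representation is
  exact and the utility ratio is a function of the utilities alone.\<close>

lemma assigned_alg_st:
  assumes S: "finite S" and w: "\<And>i. i \<in> S \<Longrightarrow> set (\<sigma> i) = {..<p}"
  shows "assigned p (alg_st S c v \<sigma>) = set (take (\<Sum>l<p. c l) (candidate_order S v))"
proof -
  let ?xs = "candidate_order S v"
  define \<omega> where "\<omega> = (\<lambda>r. \<sigma> (?xs ! r))"
  have val: "set (\<omega> r) = {..<p}" if "r < card S" for r
    using that w[of "?xs ! r"] S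
    by (metis \<omega>_def length_candidate_order nth_mem set_candidate_order)
  have *: "?xs ! s \<in> assigned p (alg_st S c v \<sigma>) \<longleftrightarrow> s < (\<Sum>l<p. c l)" if s: "s < card S" for s
  proof -
    have "top_choice (\<omega> s) (vacant c \<omega> s) \<noteq> None \<longleftrightarrow> s < (\<Sum>l<p. c l)"
      using s val by (intro top_choice_vacant_ne_None) auto
    moreover have "l < p" if "top_choice (\<omega> s) (vacant c \<omega> s) = Some l" for l
      using top_choice_SomeD(1)[OF that] val[OF s] by auto
    ultimately show ?thesis
      using alg_st_nth[OF S s, of c v \<sigma>] by (auto simp: assigned_def \<omega>_def)
  qed
  have "i \<in> S" if "i \<in> assigned p (alg_st S c v \<sigma>)" for i
    using alg_st_outside[OF S, of i c v \<sigma>] that by (cases "i \<in> S") (auto simp: assigned_def)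
  then have sub: "assigned p (alg_st S c v \<sigma>) \<subseteq> set ?xs"
    using S by (auto simp: set_candidate_order)
  show ?thesis
  proof (rule set_eqI)
    fix i
    show "i \<in> assigned p (alg_st S c v \<sigma>) \<longleftrightarrow> i \<in> set (take (\<Sum>l<p. c l) ?xs)"
    proof (cases "i \<in> set ?xs")
      case True
      then obtain s where s: "s < card S" "i = ?xs ! s"
        by (auto simp: in_set_conv_nth length_candidate_order)
      have "i \<in> set (take (\<Sum>l<p. c l) ?xs) \<longleftrightarrow> s < (\<Sum>l<p. c l)"
        using s distinct_candidate_order[OF S, of v]
        by (auto simp: in_set_conv_nth length_candidate_order nth_eq_iff_index_eq)
      then show ?thesis using *[OF s(1)] s(2) by simp
    next
      case False
      with sub show ?thesis by (meson in_set_takeD subset_iff)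
    qed
  qed
qed

text \<open>Once all slots are full nobody gets a first choice, so only as many lists matter as
  there are slots, and those form a finite prefix of the order.\<close>

lemma card_first_choice_alg_st:
  fixes c :: "nat \<Rightarrow> nat" and v :: "nat \<Rightarrow> real" and \<sigma> :: "nat \<Rightarrow> nat list"
  assumes S: "finite S" and w: "\<And>i. i \<in> S \<Longrightarrow> set (\<sigma> i) = {..<p}" and p: "0 < p"
    and c: "(\<Sum>l<p. c l) \<le> card S"
  defines "\<omega> \<equiv> \<lambda>r. \<sigma> (candidate_order S v ! r)"
  shows "card {i \<in> S. alg_st S c v \<sigma> i = Some (hd (\<sigma> i))} =
     card {s. s < (\<Sum>l<p. c l) \<and> hd (\<omega> s) \<in> vacant c \<omega> s}"
proof -
  let ?xs = "candidate_order S v"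
  have val: "set (\<omega> r) = {..<p}" if "r < card S" for r
    using that w[of "?xs ! r"] S
    by (metis \<omega>_def length_candidate_order nth_mem set_candidate_order)
  have "{i \<in> S. alg_st S c v \<sigma> i = Some (hd (\<sigma> i))} =
      (!) ?xs ` {s. s < card S \<and> top_choice (\<omega> s) (vacant c \<omega> s) = Some (hd (\<omega> s))}"
    using S alg_st_nth[OF S, of _ c v \<sigma>]
    by (auto simp: \<omega>_def image_iff)
      (metis in_set_conv_nth length_candidate_order set_candidate_order)+
  also have "{s. s < card S \<and> top_choice (\<omega> s) (vacant c \<omega> s) = Some (hd (\<omega> s))} =
      {s. s < (\<Sum>l<p. c l) \<and> hd (\<omega> s) \<in> vacant c \<omega> s}"
  proof -
    have "s < (\<Sum>l<p. c l)"
      if "s < card S" "top_choice (\<omega> s) (vacant c \<omega> s) = Some (hd (\<omega> s))" for s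
      using top_choice_vacant_ne_None[of s \<omega> p c] val that by auto
    moreover have "top_choice (\<omega> s) (vacant c \<omega> s) = Some (hd (\<omega> s)) \<longleftrightarrow> hd (\<omega> s) \<in> vacant c \<omega> s"
      if "s < card S" for s
    proof (rule top_choice_eq_hd_iff)
      have "0 \<in> set (\<omega> s)" unfolding val[OF that] using p by simp
      then show "\<omega> s \<noteq> []" by (metis empty_iff list.set(1))
    qed
    ultimately show ?thesis using c by fastforce
  qed
  finally have *: "{i \<in> S. alg_st S c v \<sigma> i = Some (hd (\<sigma> i))} =
      (!) ?xs ` {s. s < (\<Sum>l<p. c l) \<and> hd (\<omega> s) \<in> vacant c \<omega> s}" .
  have "inj_on ((!) ?xs) {s. s < (\<Sum>l<p. c l) \<and> hd (\<omega> s) \<in> vacant c \<omega> s}"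
    using c by (intro inj_on_nth distinct_candidate_order S) (auto simp: length_candidate_order)
  with * show ?thesis
    by (simp add: card_image)
qed

section \<open>Rescaled sums and Hoeffding's inequality for counts\<close>

text \<open>A Riemann-sum comparison: each index \<open>i\<close> is visited by the integers between
  \<mu> i and \<mu> (i + 1), which are \<mu> many up to rounding. Because \<open>g\<close> is
  monotone, the rounding errors telescope to one term of size \<open>b\<close>.\<close>

lemma sum_time_change:
  fixes g :: "nat \<Rightarrow> real" and \<mu> :: real
  assumes \<mu>: "0 < \<mu>" and mono: "\<And>i j. i \<le> j \<Longrightarrow> j < T \<Longrightarrow> g i \<le> g j"
    and nonneg: "\<And>i. i < T \<Longrightarrow> 0 \<le> g i"
    and b: "\<And>i. i < T \<Longrightarrow> g i \<le> b" "0 \<le> b"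
  shows "\<bar>(\<Sum>s<nat \<lceil>\<mu> * T\<rceil>. g (nat \<lfloor>s / \<mu>\<rfloor>)) - \<mu> * (\<Sum>i<T. g i)\<bar> \<le> b"
proof -
  define e where "e T = of_int \<lceil>\<mu> * real T\<rceil> - \<mu> * real T" for T :: nat
  define diff where "diff T = (\<Sum>s<nat \<lceil>\<mu> * T\<rceil>. g (nat \<lfloor>s / \<mu>\<rfloor>)) - \<mu> * (\<Sum>i<T. g i)" for T :: nat
  have e: "0 \<le> e T" "e T \<le> 1" for T
    unfolding e_def by linarith+
  \<comment> \<open>\<open>e T\<close> is the part of the time axis that rounding adds; it is charged at rate at most \<open>b\<close>.\<close>
  have "(e T - 1) * b \<le> diff T \<and> diff T \<le> e T * b"
    using mono nonneg b
  proof (induction T arbitrary: b)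
    case 0
    then show ?case by (simp add: e_def diff_def)
  next
    case (Suc T)
    \<comment> \<open>Since \<open>b\<close> is arbitrary in the induction, it can be lowered to
      \<open>g T\<close>, which dominates all earlier values by monotonicity; this is what makes the
      errors telescope.\<close>
    have IH: "(e T - 1) * g T \<le> diff T \<and> diff T \<le> e T * g T"
      using Suc.prems by (intro Suc.IH) auto
    have le: "nat \<lceil>\<mu> * T\<rceil> \<le> nat \<lceil>\<mu> * Suc T\<rceil>"
      using \<mu> by (intro nat_mono ceiling_mono) auto
    have fl: "nat \<lfloor>s / \<mu>\<rfloor> = T" if "s \<in> {nat \<lceil>\<mu> * T\<rceil>..<nat \<lceil>\<mu> * Suc T\<rceil>}" for s :: nat
    proof -
      have "\<mu> * T \<le> s" "s < \<mu> * Suc T"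
        using that by (auto simp: nat_le_iff ceiling_le_iff) linarith
      then have "T \<le> s / \<mu>" "s / \<mu> < T + 1"
        using \<mu> by (auto simp: field_simps)
      then have "\<lfloor>s / \<mu>\<rfloor> = int T"
        by (intro floor_unique) auto
      then show ?thesis by simp
    qed
    have "(\<Sum>s<nat \<lceil>\<mu> * Suc T\<rceil>. g (nat \<lfloor>s / \<mu>\<rfloor>)) =
        (\<Sum>s<nat \<lceil>\<mu> * T\<rceil>. g (nat \<lfloor>s / \<mu>\<rfloor>)) +
        (\<Sum>s\<in>{nat \<lceil>\<mu> * T\<rceil>..<nat \<lceil>\<mu> * Suc T\<rceil>}. g (nat \<lfloor>s / \<mu>\<rfloor>))"
      unfolding lessThan_atLeast0 by (rule sum.atLeastLessThan_concat[OF _ le, symmetric]) (rule zero_le)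
    also have "(\<Sum>s\<in>{nat \<lceil>\<mu> * T\<rceil>..<nat \<lceil>\<mu> * Suc T\<rceil>}. g (nat \<lfloor>s / \<mu>\<rfloor>)) =
        (\<Sum>s\<in>{nat \<lceil>\<mu> * T\<rceil>..<nat \<lceil>\<mu> * Suc T\<rceil>}. g T)"
      by (rule sum.cong[OF refl]) (simp add: fl)
    also have "\<dots> = (real (nat \<lceil>\<mu> * Suc T\<rceil>) - real (nat \<lceil>\<mu> * T\<rceil>)) * g T"
      using le by (simp add: of_nat_diff)
    also have "real (nat \<lceil>\<mu> * Suc T\<rceil>) - real (nat \<lceil>\<mu> * T\<rceil>) = e (Suc T) - e T + \<mu>"
    proof -
      have "0 \<le> \<mu> * T" "0 \<le> \<mu> * Suc T" using \<mu> by auto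
      then have "real (nat \<lceil>\<mu> * T\<rceil>) = \<lceil>\<mu> * T\<rceil>" "real (nat \<lceil>\<mu> * Suc T\<rceil>) = \<lceil>\<mu> * Suc T\<rceil>"
        by linarith+
      then show ?thesis by (simp add: e_def algebra_simps)
    qed
    finally have step: "diff (Suc T) = diff T + (e (Suc T) - e T) * g T"
      by (simp add: diff_def algebra_simps)
    have gT: "0 \<le> g T" "g T \<le> b" using Suc.prems by auto
    have "diff (Suc T) \<le> e (Suc T) * g T" "(e (Suc T) - 1) * g T \<le> diff (Suc T)"
      using IH step by (simp_all add: algebra_simps)
    moreover have "e (Suc T) * g T \<le> e (Suc T) * b"
      using gT e[of "Suc T"] by (intro mult_left_mono) auto
    moreover have "(e (Suc T) - 1) * b \<le> (e (Suc T) - 1) * g T"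
      using gT e[of "Suc T"] by (intro mult_left_mono_neg) auto
    ultimately show ?case by linarith
  qed
  moreover have "e T * b \<le> 1 * b" "(- 1) * b \<le> (e T - 1) * b"
    using e[of T] b(2) by (intro mult_right_mono; simp)+
  ultimately show ?thesis by (auto simp: diff_def)
qed

section \<open>Finite products of discrete distributions and Hoeffding's inequality\<close>

text \<open>A finite power of a countable type carries the discrete sigma-algebra, so no
  measurability question arises for preferences.\<close>

lemma measurable_PiM_measure_pmf:
  fixes L :: "'a :: countable pmf"
  assumes "finite I"
  shows "f \<in> PiM I (\<lambda>_. measure_pmf L) \<rightarrow>\<^sub>M N \<longleftrightarrow> f \<in> PiE I (\<lambda>_. UNIV) \<rightarrow> space N"
proof -
  have "sets (PiM I (\<lambda>_. measure_pmf L)) = sets (PiM I (\<lambda>_. count_space (UNIV :: 'a set)))"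
    by (intro sets_PiM_cong) auto
  also have "PiM I (\<lambda>_. count_space (UNIV :: 'a set)) = count_space (PiE I (\<lambda>_. UNIV))"
    using assms by (intro count_space_PiM_finite) auto
  finally have "measurable (PiM I (\<lambda>_. measure_pmf L)) N = measurable (count_space (PiE I (\<lambda>_. UNIV))) N"
    by (intro measurable_cong_sets) auto
  then show ?thesis by simp
qed

lemma sets_PiM_measure_pmf:
  fixes L :: "'a :: countable pmf"
  assumes "finite I"
  shows "sets (PiM I (\<lambda>_. measure_pmf L)) = Pow (PiE I (\<lambda>_. UNIV))"
proof -
  have "sets (PiM I (\<lambda>_. measure_pmf L)) = sets (PiM I (\<lambda>_. count_space (UNIV :: 'a set)))"
    by (intro sets_PiM_cong) auto
  also have "PiM I (\<lambda>_. count_space (UNIV :: 'a set)) = count_space (PiE I (\<lambda>_. UNIV))"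
    using assms by (intro count_space_PiM_finite) auto
  finally show ?thesis by simp
qed

text \<open>The event may vary with the position but not with the outcome. Prescribed vacant sets
  satisfy this; the true ones do not.\<close>

lemma Hoeffding_card:
  fixes L :: "'a :: countable pmf" and E :: "nat \<Rightarrow> 'a set" and m :: nat and d :: real
  assumes d: "0 \<le> d" and m: "0 < m"
  defines "P \<equiv> PiM {..<m} (\<lambda>_. measure_pmf L)"
  defines "\<nu> \<equiv> \<Sum>s<m. measure_pmf.prob L (E s)"
  shows "measure P {\<omega> \<in> space P. real (card {s. s < m \<and> \<omega> s \<in> E s}) \<ge> \<nu> + d} \<le> exp (- 2 * d\<^sup>2 / m)"
    and "measure P {\<omega> \<in> space P. real (card {s. s < m \<and> \<omega> s \<in> E s}) \<le> \<nu> - d} \<le> exp (- 2 * d\<^sup>2 / m)"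
proof -
  interpret P: prob_space P
    unfolding P_def by (intro prob_space_PiM measure_pmf.prob_space_axioms)
  define X where "X s \<omega> = (indicator (E s) (\<omega> s) :: real)" for s :: nat and \<omega> :: "nat \<Rightarrow> 'a"
  have distr: "distr P (measure_pmf L) (\<lambda>\<omega>. \<omega> s) = measure_pmf L" if "s < m" for s
    unfolding P_def using that by (intro distr_PiM_component) (auto intro: measure_pmf.prob_space_axioms)
  have meas: "(\<lambda>\<omega>. \<omega> s) \<in> P \<rightarrow>\<^sub>M measure_pmf L" if "s < m" for s
    unfolding P_def using that by (intro measurable_component_singleton) auto
  have "P.indep_vars (\<lambda>_. measure_pmf L) (\<lambda>s \<omega>. \<omega> s) {..<m}"
  proof (subst P.indep_vars_iff_distr_eq_PiM')
    show "distr P (PiM {..<m} (\<lambda>_. measure_pmf L)) (\<lambda>x. \<lambda>i\<in>{..<m}. x i) =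
        PiM {..<m} (\<lambda>i. distr P (measure_pmf L) (\<lambda>\<omega>. \<omega> i))"
    proof -
      have "distr P (PiM {..<m} (\<lambda>_. measure_pmf L)) (\<lambda>x. \<lambda>i\<in>{..<m}. x i) = distr P P (\<lambda>x. x)"
        by (intro distr_cong) (auto simp: P_def space_PiM)
      also have "\<dots> = PiM {..<m} (\<lambda>i. distr P (measure_pmf L) (\<lambda>\<omega>. \<omega> i))"
        by (simp add: P_def, rule PiM_cong) (use distr in \<open>auto simp: P_def\<close>)
      finally show ?thesis .
    qed
  qed (use m meas in auto)
  then have "P.indep_vars (\<lambda>_. borel) (\<lambda>s. indicator (E s) \<circ> (\<lambda>\<omega>. \<omega> s)) {..<m}"
    by (rule P.indep_vars_compose) auto
  then have indep: "P.indep_vars (\<lambda>_. borel) X {..<m}"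
    unfolding X_def comp_def .
  have "(\<Sum>s<m. P.expectation (X s)) = \<nu>"
    unfolding \<nu>_def
  proof (rule sum.cong[OF refl])
    fix s assume "s \<in> {..<m}"
    then have s: "s < m" by simp
    have "P.expectation (X s) = (\<integral>w. indicator (E s) w \<partial>distr P (measure_pmf L) (\<lambda>\<omega>. \<omega> s))"
      unfolding X_def by (subst integral_distr[OF meas[OF s]]) auto
    then show "P.expectation (X s) = measure_pmf.prob L (E s)"
      by (simp add: distr[OF s])
  qed
  then have \<nu>: "\<nu> \<equiv> \<Sum>s<m. P.expectation (X s)"
    by (intro eq_reflection) (rule sym)
  have AE: "AE \<omega> in P. X s \<omega> \<in> {0..1}" for s
    by (simp add: X_def indicator_def)
  interpret H: Hoeffding_ineq P "{..<m}" X "\<lambda>_. 0" "\<lambda>_. 1" \<nu>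
    by (unfold_locales) (rule finite_lessThan indep AE \<nu>)+
  have card: "(\<Sum>s<m. X s \<omega>) = real (card {s. s < m \<and> \<omega> s \<in> E s})" for \<omega>
  proof -
    have "(\<Sum>s<m. X s \<omega>) = (\<Sum>s\<in>{s\<in>{..<m}. \<omega> s \<in> E s}. 1)"
      unfolding X_def indicator_def of_bool_def by (subst sum.inter_filter) auto
    also have "\<dots> = real (card {s. s < m \<and> \<omega> s \<in> E s})"
      by (simp add: lessThan_def)
    finally show ?thesis .
  qed
  show "measure P {\<omega> \<in> space P. real (card {s. s < m \<and> \<omega> s \<in> E s}) \<ge> \<nu> + d} \<le> exp (- 2 * d\<^sup>2 / m)"
    using H.Hoeffding_ineq_ge[OF d] m by (simp add: card)
  show "measure P {\<omega> \<in> space P. real (card {s. s < m \<and> \<omega> s \<in> E s}) \<le> \<nu> - d} \<le> exp (- 2 * d\<^sup>2 / m)"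
    using H.Hoeffding_ineq_le[OF d] m by (simp add: card)
qed

section \<open>The fluid limit of the assignment process\<close>

definition share :: "nat list pmf \<Rightarrow> nat set \<Rightarrow> nat \<Rightarrow> real" where
  "share L A l = measure_pmf.prob L {w. top_choice w A = Some l}"

lemma share_nonneg: "0 \<le> share L A l"
  and share_le_1: "share L A l \<le> 1"
  by (simp_all add: share_def)

lemma share_eq_0: "l \<notin> A \<Longrightarrow> share L A l = 0"
proof -
  assume "l \<notin> A"
  then have "{w. top_choice w A = Some l} = {}"
    using top_choice_SomeD(2)[of _ A l] by blast
  then show ?thesis by (simp only: share_def measure_empty)
qed

text \<open>Closing other institutions only diverts candidates towards the remaining ones. Along the
  fluid, the share of a living institution therefore grows, as \<open>sum_time_change\<close>
  requires.\<close>

lemma share_antimono: "l \<in> A \<Longrightarrow> A \<subseteq> B \<Longrightarrow> share L B l \<le> share L A l"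
  unfolding share_def
  by (intro measure_pmf.finite_measure_mono) (auto dest: top_choice_antimono)

lemma sum_prob_eq_1:
  fixes p :: nat
  assumes "\<And>w. w \<in> set_pmf L \<Longrightarrow> f w \<in> (\<lambda>l. h l) ` {..<p}" "inj h"
  shows "(\<Sum>l<p. measure_pmf.prob L {w. f w = h l}) = 1"
proof -
  have "(\<Sum>l<p. measure_pmf.prob L {w. f w = h l}) = measure_pmf.prob L (\<Union>l<p. {w. f w = h l})"
    using assms(2)
    by (intro measure_pmf.finite_measure_finite_Union[symmetric] finite_lessThan)
      (auto simp: disjoint_family_on_def dest: injD)
  also have "\<dots> = 1"
    using assms(1) by (intro measure_pmf.prob_eq_1[THEN iffD2]) (auto simp: AE_measure_pmf_iff)
  finally show ?thesis .
qed

lemma sum_share: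
  assumes "\<And>w. w \<in> set_pmf L \<Longrightarrow> set w = {..<p}" "A \<inter> {..<p} \<noteq> {}"
  shows "(\<Sum>l<p. share L A l) = 1"
  unfolding share_def
proof (rule sum_prob_eq_1)
  fix w assume "w \<in> set_pmf L"
  then have w: "set w = {..<p}" by (rule assms)
  then have "top_choice w A \<noteq> None"
    unfolding top_choice_eq_None_iff using assms(2) by blast
  then obtain l where l: "top_choice w A = Some l" by blast
  with top_choice_SomeD(1)[OF l] w show "top_choice w A \<in> Some ` {..<p}"
    by blast
qed simp

text \<open>
  Time is discrete, so an institution may be overfilled by less than one slot; it is alive as long as
  its remaining capacity is positive.
\<close>

primrec fluid :: "nat list pmf \<Rightarrow> (nat \<Rightarrow> nat) \<Rightarrow> nat \<Rightarrow> nat \<Rightarrow> nat \<Rightarrow> real" where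
  "fluid L k p 0 = (\<lambda>l. real (k l))"
| "fluid L k p (Suc s) = (\<lambda>l. fluid L k p s l - share L {l'. l' < p \<and> 0 < fluid L k p s l'} l)"

text \<open>Expressed through the closing times \<open>t\<close> alone: they determine the schedule,
  so the remaining capacities can be forgotten afterwards.\<close>

definition alive :: "(nat \<Rightarrow> nat) \<Rightarrow> nat \<Rightarrow> nat \<Rightarrow> nat set" where
  "alive t p s = {l. l < p \<and> s < t l}"

text \<open>The closing time is the first step with remaining capacity at most 0. One step removes
  at most 1 from an institution, so none is overfilled by more than 1; all of them together can
  delay the end by at most \<open>p\<close> steps.\<close>

lemma fluid_times:
  assumes rank: "\<And>w. w \<in> set_pmf L \<Longrightarrow> set w = {..<p}"
  obtains t :: "nat \<Rightarrow> nat" where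
    "\<And>l. l < p \<Longrightarrow> real (k l) \<le> (\<Sum>s<t l. share L (alive t p s) l)"
    "\<And>l. l < p \<Longrightarrow> (\<Sum>s<t l. share L (alive t p s) l) \<le> real (k l) + 1"
    "\<And>l. l < p \<Longrightarrow> t l \<le> (\<Sum>l<p. k l) + p"
proof -
  define r where "r = fluid L k p"
  define A where "A s = {l. l < p \<and> 0 < r s l}" for s
  have r0: "r 0 l = k l" and rS: "r (Suc s) l = r s l - share L (A s) l" for s l
    by (simp_all add: r_def A_def)
  have A_anti: "A s' \<subseteq> A s" if "s \<le> s'" for s s'
    using that
  proof (induction s' rule: dec_induct)
    case (step s')
    have "A (Suc s') \<subseteq> A s'"
    proof
      fix l assume "l \<in> A (Suc s')"
      then show "l \<in> A s'"
        using share_nonneg[of L "A s'" l] by (simp add: A_def[of s'] A_def[of "Suc s'"] rS)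
    qed
    with step.IH show ?case by blast
  qed simp
  have r_lower: "-1 \<le> r s l" if "l < p" for s l
  proof (induction s)
    case (Suc s)
    show ?case
    proof (cases "l \<in> A s")
      case True
      then show ?thesis using share_le_1[of L "A s" l] by (simp add: rS A_def[of s])
    next
      case False
      then show ?thesis using Suc by (simp add: rS share_eq_0)
    qed
  qed (simp add: r0)
  have sum_r: "(\<Sum>l<p. r s l) = real (\<Sum>l<p. k l) - real s" if "A s \<noteq> {}" for s
    using that
  proof (induction s)
    case (Suc s)
    then have ne: "A s \<noteq> {}" using A_anti[of s "Suc s"] by auto
    have "(\<Sum>l<p. share L (A s) l) = 1"
      using ne by (intro sum_share rank) (auto simp: A_def)
    then show ?case using Suc.IH[OF ne] by (simp add: rS sum_subtractf)
  qed (simp add: r0)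
  \<comment> \<open>While anything is alive, the remaining total is K - s, which at s = K + p equals
    -p. But every remainder is at least -1 and that of a living institution is positive, so the sum
    would exceed -p.\<close>
  have dead: "A ((\<Sum>l<p. k l) + p) = {}"
  proof (rule ccontr)
    define s where "s = (\<Sum>l<p. k l) + p"
    assume "A ((\<Sum>l<p. k l) + p) \<noteq> {}"
    then have ne: "A s \<noteq> {}" by (simp add: s_def)
    then obtain l0 where l0: "l0 < p" "0 < r s l0" by (auto simp: A_def)
    have "(\<Sum>l<p. -1) < (\<Sum>l<p. r s l)"
      using l0 r_lower by (intro sum_strict_mono_ex1) (auto intro!: bexI[of _ l0])
    with sum_r[OF ne] show False by (simp add: s_def)
  qed
  define t where "t l = (LEAST s. l \<notin> A s)" for l
  have not_A: "l \<notin> A (t l)" for l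
    unfolding t_def by (rule LeastI[of _ "(\<Sum>l<p. k l) + p"]) (simp add: dead)
  have A_iff: "l \<in> A s \<longleftrightarrow> s < t l" for l s
    using A_anti[of "t l" s] not_A[of l] not_less_Least[of s "\<lambda>s. l \<notin> A s"]
    unfolding t_def[symmetric] by (meson not_le subset_iff)
  have alive: "alive t p s = A s" for s
    using A_iff by (auto simp: alive_def A_def)
  have sum_share_r: "(\<Sum>i<s. share L (A i) l) = k l - r s l" for s l
    by (induction s) (simp_all add: r0 rS)
  show thesis
  proof
    fix l assume l: "l < p"
    have "r (t l) l \<le> 0" using not_A[of l] l by (auto simp: A_def)
    then show "real (k l) \<le> (\<Sum>s<t l. share L (alive t p s) l)"
      by (simp add: alive sum_share_r)
    show "(\<Sum>s<t l. share L (alive t p s) l) \<le> real (k l) + 1"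
      using r_lower[OF l, of "t l"] by (simp add: alive sum_share_r)
    show "t l \<le> (\<Sum>l<p. k l) + p"
      unfolding t_def by (rule Least_le) (simp add: dead)
  qed
qed

text \<open>The sets of alive institutions, with the time axis stretched by the factor \<open>\<mu>\<close>.\<close>

definition stretched :: "(nat \<Rightarrow> nat) \<Rightarrow> nat \<Rightarrow> real \<Rightarrow> nat \<Rightarrow> nat set" where
  "stretched t p \<mu> s = {l. l < p \<and> real s < \<mu> * real (t l)}"

lemma stretched_antimono: "r \<le> s \<Longrightarrow> stretched t p \<mu> s \<subseteq> stretched t p \<mu> r"
  by (auto simp: stretched_def)

lemma stretched_eq_alive:
  assumes "0 < \<mu>"
  shows "stretched t p \<mu> s = alive t p (nat \<lfloor>real s / \<mu>\<rfloor>)"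
proof -
  have "real s < \<mu> * real T \<longleftrightarrow> nat \<lfloor>real s / \<mu>\<rfloor> < T" for T
  proof -
    have "real s < \<mu> * real T \<longleftrightarrow> real s / \<mu> < of_int (int T)"
      using assms by (simp add: field_simps)
    also have "\<dots> \<longleftrightarrow> \<lfloor>real s / \<mu>\<rfloor> < int T"
      by (simp only: floor_less_iff)
    also have "\<dots> \<longleftrightarrow> nat \<lfloor>real s / \<mu>\<rfloor> < T"
      using assms by (subst nat_less_iff) auto
    finally show ?thesis .
  qed
  then show ?thesis by (simp add: stretched_def alive_def)
qed

text \<open>Stretching time by \<mu> multiplies the mass received by \<mu>, up to 1 for rounding.
  Truncation at \<open>m\<close> can only lose mass, so the lower bound requires that the stretched
  closing time is reached.\<close>

lemma sum_share_stretched: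
  fixes L :: "nat list pmf" and t :: "nat \<Rightarrow> nat"
  assumes \<mu>: "0 < \<mu>" and l: "l < p"
  defines "H \<equiv> \<Sum>s<t l. share L (alive t p s) l"
  shows "(\<Sum>s<m. share L (stretched t p \<mu> s) l) \<le> \<mu> * H + 1"
    and "\<mu> * real (t l) \<le> real m \<Longrightarrow> \<mu> * H - 1 \<le> (\<Sum>s<m. share L (stretched t p \<mu> s) l)"
proof -
  let ?N = "nat \<lceil>\<mu> * real (t l)\<rceil>"
  have "\<bar>(\<Sum>s<?N. share L (alive t p (nat \<lfloor>real s / \<mu>\<rfloor>)) l) - \<mu> * H\<bar> \<le> 1"
    unfolding H_def
  proof (rule sum_time_change[OF \<mu>])
    show "share L (alive t p i) l \<le> share L (alive t p j) l" if "i \<le> j" "j < t l" for i j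
      using that l by (intro share_antimono) (auto simp: alive_def)
  qed (auto simp: share_nonneg share_le_1)
  then have *: "\<bar>(\<Sum>s<?N. share L (stretched t p \<mu> s) l) - \<mu> * H\<bar> \<le> 1"
    by (simp add: stretched_eq_alive[OF \<mu>])
  have zero: "share L (stretched t p \<mu> s) l = 0" if "?N \<le> s" for s
    using that by (intro share_eq_0) (auto simp: stretched_def nat_le_iff ceiling_le_iff)
  have "(\<Sum>s<m. share L (stretched t p \<mu> s) l) \<le> (\<Sum>s<max m ?N. share L (stretched t p \<mu> s) l)"
    by (intro sum_mono2) (auto simp: share_nonneg)
  also have "\<dots> = (\<Sum>s<?N. share L (stretched t p \<mu> s) l)"
    by (intro sum.mono_neutral_right) (auto simp: zero)
  finally show "(\<Sum>s<m. share L (stretched t p \<mu> s) l) \<le> \<mu> * H + 1"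
    using * by linarith
  assume "\<mu> * real (t l) \<le> real m"
  then have "?N \<le> m" by (simp add: nat_le_iff ceiling_le_iff)
  then have "(\<Sum>s<?N. share L (stretched t p \<mu> s) l) \<le> (\<Sum>s<m. share L (stretched t p \<mu> s) l)"
    by (intro sum_mono2) (auto simp: share_nonneg)
  then show "\<mu> * H - 1 \<le> (\<Sum>s<m. share L (stretched t p \<mu> s) l)"
    using * by linarith
qed

lemma sum_prob_hd:
  fixes L :: "nat list pmf"
  assumes rank: "\<And>w. w \<in> set_pmf L \<Longrightarrow> set w = {..<p}" and p: "0 < p"
  shows "(\<Sum>l<p. measure_pmf.prob L {w. hd w = l}) = 1"
proof (rule sum_prob_eq_1)
  fix w assume "w \<in> set_pmf L"
  then have w: "set w = {..<p}" by (rule rank)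
  have "w \<noteq> []" using w p by (metis empty_iff lessThan_iff list.set(1))
  then have "hd w \<in> set w" by simp
  then show "hd w \<in> (\<lambda>l. l) ` {..<p}" unfolding w by simp
qed simp

lemma prob_hd_stretched:
  "measure_pmf.prob L {w. hd w \<in> stretched t p \<mu> s} =
     (\<Sum>l<p. measure_pmf.prob L {w. hd w = l} * (if real s < \<mu> * real (t l) then 1 else 0))"
proof -
  have "{w. hd w \<in> stretched t p \<mu> s} = (\<Union>l\<in>stretched t p \<mu> s. {w. hd w = l})"
    by auto
  also have "measure_pmf.prob L \<dots> = (\<Sum>l\<in>stretched t p \<mu> s. measure_pmf.prob L {w. hd w = l})"
    by (rule measure_pmf.finite_measure_finite_Union) (auto simp: disjoint_family_on_def stretched_def)
  also have "\<dots> = (\<Sum>l<p. if real s < \<mu> * real (t l) then measure_pmf.prob L {w. hd w = l} else 0)"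
    by (subst sum.inter_filter[symmetric]) (auto simp: stretched_def intro: sum.cong)
  finally show ?thesis by (simp add: if_distrib cong: if_cong)
qed

text \<open>After exchanging the sums, institution \<open>l\<close> contributes its probability of
  being ranked first times the roughly \<mu> \<open>t l\<close> steps during which it is open. Thus
  \<open>F\<close> is the fluid's total of first choices, or the mean closing time of a random first
  choice.\<close>

lemma sum_prob_hd_stretched:
  fixes L :: "nat list pmf" and t :: "nat \<Rightarrow> nat"
  assumes rank: "\<And>w. w \<in> set_pmf L \<Longrightarrow> set w = {..<p}" and p: "0 < p" and \<mu>: "0 < \<mu>"
  defines "F \<equiv> \<Sum>l<p. measure_pmf.prob L {w. hd w = l} * real (t l)"
  shows "(\<Sum>s<m. measure_pmf.prob L {w. hd w \<in> stretched t p \<mu> s}) \<le> \<mu> * F + 1"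
    and "(\<And>l. l < p \<Longrightarrow> \<mu> * real (t l) \<le> real m) \<Longrightarrow>
      \<mu> * F \<le> (\<Sum>s<m. measure_pmf.prob L {w. hd w \<in> stretched t p \<mu> s})"
proof -
  let ?q = "\<lambda>l. measure_pmf.prob L {w. hd w = l}"
  define N where "N l = card {s. s < m \<and> real s < \<mu> * real (t l)}" for l
  have "(\<Sum>s<m. if real s < \<mu> * real (t l) then 1 else 0) = real (N l)" for l
  proof -
    have "(\<Sum>s<m. if real s < \<mu> * real (t l) then 1 else 0) =
        (\<Sum>s\<in>{s\<in>{..<m}. real s < \<mu> * real (t l)}. 1 :: real)"
      by (subst sum.inter_filter) auto
    then show ?thesis by (simp add: N_def)
  qed
  then have eq: "(\<Sum>s<m. measure_pmf.prob L {w. hd w \<in> stretched t p \<mu> s}) = (\<Sum>l<p. ?q l * real (N l))"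
    unfolding prob_hd_stretched by (subst sum.swap) (simp flip: sum_distrib_left)
  have q1: "(\<Sum>l<p. ?q l) = 1" by (rule sum_prob_hd[OF rank p])
  have N_le: "real (N l) \<le> \<mu> * real (t l) + 1" for l
  proof -
    have "N l \<le> card {..<nat \<lceil>\<mu> * real (t l)\<rceil>}"
      unfolding N_def by (intro card_mono) (auto simp: zless_nat_eq_int_zless less_ceiling_iff)
    moreover have "0 \<le> \<mu> * real (t l)" using \<mu> by simp
    ultimately show ?thesis by simp linarith
  qed
  have "(\<Sum>l<p. ?q l * real (N l)) \<le> (\<Sum>l<p. ?q l * (\<mu> * real (t l) + 1))"
    by (intro sum_mono mult_left_mono N_le) auto
  also have "\<dots> = \<mu> * F + 1"
    using q1 by (simp add: F_def sum.distrib algebra_simps sum_distrib_left)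
  finally show "(\<Sum>s<m. measure_pmf.prob L {w. hd w \<in> stretched t p \<mu> s}) \<le> \<mu> * F + 1"
    by (simp add: eq)
  assume le: "\<And>l. l < p \<Longrightarrow> \<mu> * real (t l) \<le> real m"
  have N_ge: "\<mu> * real (t l) \<le> real (N l)" if "l < p" for l
  proof -
    have "nat \<lceil>\<mu> * real (t l)\<rceil> \<le> m"
      using le[OF that] by (simp add: nat_le_iff ceiling_le_iff)
    then have "card {..<nat \<lceil>\<mu> * real (t l)\<rceil>} \<le> N l"
      unfolding N_def by (intro card_mono) (auto simp: zless_nat_eq_int_zless less_ceiling_iff)
    then show ?thesis by simp
  qed
  have "\<mu> * F = (\<Sum>l<p. ?q l * (\<mu> * real (t l)))"
    by (simp add: F_def sum_distrib_left algebra_simps)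
  also have "\<dots> \<le> (\<Sum>l<p. ?q l * real (N l))"
    by (intro sum_mono mult_left_mono N_ge) auto
  finally show "\<mu> * F \<le> (\<Sum>s<m. measure_pmf.prob L {w. hd w \<in> stretched t p \<mu> s})"
    by (simp add: eq)
qed

text \<open>A first choice is granted exactly when it is vacant, so inclusions of sets become
  inequalities of counts. In \<open>fast\<close>, institutions that stay open until \<open>m\<close>
  are exempt, since they belong to the prescribed sets throughout.\<close>

lemma first_choice_sandwich:
  fixes \<omega> :: "nat \<Rightarrow> nat list" and c t :: "nat \<Rightarrow> nat"
  assumes valid: "\<And>s. s < m \<Longrightarrow> set (\<omega> s) = {..<p}" and p: "0 < p"
    and slow: "\<And>l. l < p \<Longrightarrow> card {s. s < m \<and> top_choice (\<omega> s) (stretched t p \<mu> s) = Some l} < c l"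
    and fast: "\<And>l. l < p \<Longrightarrow> \<mu>' * real (t l) \<le> real m \<Longrightarrow>
      c l \<le> card {s. s < m \<and> top_choice (\<omega> s) (stretched t p \<mu>' s) = Some l}"
  shows "card {s. s < m \<and> hd (\<omega> s) \<in> stretched t p \<mu> s} \<le> card {s. s < m \<and> hd (\<omega> s) \<in> vacant c \<omega> s}"
    and "card {s. s < m \<and> hd (\<omega> s) \<in> vacant c \<omega> s} \<le> card {s. s < m \<and> hd (\<omega> s) \<in> stretched t p \<mu>' s}"
proof -
  have "stretched t p \<mu> s \<subseteq> vacant c \<omega> s" if "s < m" for s
    using that slow by (intro vacant_superset[where m = m] stretched_antimono) (auto simp: stretched_def)
  then show "card {s. s < m \<and> hd (\<omega> s) \<in> stretched t p \<mu> s} \<le> card {s. s < m \<and> hd (\<omega> s) \<in> vacant c \<omega> s}"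
    by (intro card_mono) auto
  have sub: "vacant c \<omega> s \<inter> {..<p} \<subseteq> stretched t p \<mu>' s" if "s < m" for s
  proof (rule vacant_subset[where m = m])
    fix l assume "l \<in> {..<p}"
    then show "(\<forall>s<m. l \<in> stretched t p \<mu>' s) \<or>
        c l \<le> card {r. r < m \<and> top_choice (\<omega> r) (stretched t p \<mu>' r) = Some l}"
      using fast[of l] by (cases "\<mu>' * real (t l) \<le> real m") (auto simp: stretched_def)
  qed (use that valid in \<open>auto intro: stretched_antimono[THEN subsetD]\<close>)
  have "hd (\<omega> s) \<in> {..<p}" if "s < m" for s
  proof -
    have "\<omega> s \<noteq> []" using valid[OF that] p by (metis empty_iff lessThan_iff list.set(1))
    then show ?thesis unfolding valid[OF that, symmetric] by simp
  qed
  with sub show "card {s. s < m \<and> hd (\<omega> s) \<in> vacant c \<omega> s} \<le> card {s. s < m \<and> hd (\<omega> s) \<in> stretched t p \<mu>' s}"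
    by (intro card_mono) auto
qed

text \<open>The factor \<open>2 * real p + 2\<close> counts Hoeffding events: for each institution
  one count that must not be too large and one that must not be too small, and two counts of first
  choices.\<close>

lemma first_choice_concentration:
  fixes L :: "nat list pmf" and k c t :: "nat \<Rightarrow> nat" and \<alpha> \<epsilon> d :: real
  assumes rank: "\<And>w. w \<in> set_pmf L \<Longrightarrow> set w = {..<p}" and p: "0 < p"
    and t1: "\<And>l. l < p \<Longrightarrow> real (k l) \<le> (\<Sum>s<t l. share L (alive t p s) l)"
    and t2: "\<And>l. l < p \<Longrightarrow> (\<Sum>s<t l. share L (alive t p s) l) \<le> real (k l) + 1"
    and t3: "\<And>l. l < p \<Longrightarrow> t l \<le> (\<Sum>l<p. k l) + p"
    and lam: "0 < \<alpha>" "\<alpha> \<le> 1" "\<And>l. l < p \<Longrightarrow> real (c l) = \<alpha> * real (k l)"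
    and eps: "0 < \<epsilon>" "\<epsilon> < 1" and d: "0 \<le> d" "\<And>l. l < p \<Longrightarrow> d + 2 \<le> \<epsilon> * real (c l)"
    and pK: "real p \<le> \<epsilon> * real (\<Sum>l<p. k l)"
  defines "m \<equiv> \<Sum>l<p. c l"
  defines "F \<equiv> \<Sum>l<p. measure_pmf.prob L {w. hd w = l} * real (t l)"
  defines "P \<equiv> PiM {..<m} (\<lambda>_. measure_pmf L)"
  assumes m: "0 < m" and dF: "d \<le> \<epsilon> * (\<alpha> * F)"
  shows "1 - (2 * real p + 2) * exp (- 2 * d\<^sup>2 / m) \<le>
    measure P {\<omega> \<in> space P. (\<forall>s<m. set (\<omega> s) = {..<p}) \<and>
      (1 - 2 * \<epsilon>) * (\<alpha> * F) \<le> card {s. s < m \<and> hd (\<omega> s) \<in> vacant c \<omega> s} \<and>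
      card {s. s < m \<and> hd (\<omega> s) \<in> vacant c \<omega> s} \<le> (1 + 2 * \<epsilon>) * (\<alpha> * F) + 1}"
    (is "_ \<le> measure P ?Good")
proof -
  interpret P: prob_space P
    unfolding P_def by (intro prob_space_PiM measure_pmf.prob_space_axioms)
  have sets: "A \<in> P.events" if "A \<subseteq> space P" for A
    using that by (simp add: P_def sets_PiM_measure_pmf space_PiM)
  \<comment> \<open>With the factor 1 - \<epsilon> institutions close early and end up underfilled;
    with 1 + \<epsilon> they close late and end up full.\<close>
  define \<mu> where "\<mu> = (1 - \<epsilon>) * \<alpha>"
  define \<mu>' where "\<mu>' = (1 + \<epsilon>) * \<alpha>"
  have \<mu>: "0 < \<mu>" "0 < \<mu>'" using eps lam by (auto simp: \<mu>_def \<mu>'_def)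
  have lamK: "\<alpha> * real (\<Sum>l<p. k l) = real m"
    using lam(3) by (simp add: m_def sum_distrib_left)
  \<comment> \<open>The fluid may outlast K by \<open>p\<close> steps; \<open>pK\<close> bounds this
    by a factor 1 + \<epsilon>, which the factor 1 - \<epsilon> of \<mu> compensates.\<close>
  have \<mu>t: "\<mu> * real (t l) \<le> real m" if "l < p" for l
  proof -
    have "\<mu> * real (t l) \<le> \<mu> * (real (\<Sum>l<p. k l) + real p)"
      using of_nat_mono[OF t3[OF that], where 'a = real] \<mu>
      unfolding of_nat_add by (intro mult_left_mono) auto
    also have "\<dots> \<le> \<mu> * (real (\<Sum>l<p. k l) + \<epsilon> * real (\<Sum>l<p. k l))"
      using pK \<mu> by (intro mult_left_mono) auto
    also have "\<dots> = (1 - \<epsilon>\<^sup>2) * (\<alpha> * real (\<Sum>l<p. k l))"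
      by (simp add: \<mu>_def power2_eq_square algebra_simps)
    also have "\<dots> \<le> 1 * real m"
      unfolding lamK by (intro mult_right_mono) auto
    finally show ?thesis by simp
  qed
  define H where "H l = (\<Sum>s<t l. share L (alive t p s) l)" for l
  define \<nu> where "\<nu> \<mu> l = (\<Sum>s<m. share L (stretched t p \<mu> s) l)" for \<mu> l
  \<comment> \<open>In \<open>d + 2\<close>, one unit pays for rounding the stretched time and the
    other for the overshoot of the fluid.\<close>
  have slow_mean: "\<nu> \<mu> l + d \<le> c l" if "l < p" for l
  proof -
    have "\<nu> \<mu> l \<le> \<mu> * H l + 1"
      unfolding \<nu>_def H_def by (rule sum_share_stretched[OF \<mu>(1) that])
    also have "\<mu> * H l \<le> \<mu> * (real (k l) + 1)"
      using t2[OF that] \<mu> by (intro mult_left_mono) (auto simp: H_def)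
    also have "\<mu> * (real (k l) + 1) = (1 - \<epsilon>) * real (c l) + \<mu>"
      using lam(3)[OF that] by (simp add: \<mu>_def algebra_simps)
    also have "\<mu> \<le> 1 * 1" unfolding \<mu>_def using eps lam by (intro mult_mono) auto
    finally show ?thesis using d(2)[OF that] by (simp add: algebra_simps)
  qed
  have fast_mean: "c l \<le> \<nu> \<mu>' l - d" if "l < p" "\<mu>' * real (t l) \<le> real m" for l
  proof -
    have "(1 + \<epsilon>) * real (c l) = \<mu>' * real (k l)"
      using lam(3)[OF that(1)] by (simp add: \<mu>'_def)
    also have "\<dots> \<le> \<mu>' * H l"
      using t1[OF that(1)] \<mu> by (intro mult_left_mono) (auto simp: H_def)
    also have "\<mu>' * H l - 1 \<le> \<nu> \<mu>' l"
      unfolding \<nu>_def H_def using that by (intro sum_share_stretched(2)[OF \<mu>(2)])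
    finally show ?thesis using d(2)[OF that(1)] by (simp add: algebra_simps)
  qed
  define h where "h \<mu> = (\<Sum>s<m. measure_pmf.prob L {w. hd w \<in> stretched t p \<mu> s})" for \<mu>
  have h_low: "(1 - \<epsilon>) * (\<alpha> * F) \<le> h \<mu>"
    using sum_prob_hd_stretched(2)[of L p \<mu> t m, OF rank p \<mu>(1) \<mu>t] by (simp add: h_def F_def \<mu>_def algebra_simps)
  have h_up: "h \<mu>' \<le> (1 + \<epsilon>) * (\<alpha> * F) + 1"
    using sum_prob_hd_stretched(1)[of L p \<mu>' t m, OF rank p \<mu>(2)] by (simp add: h_def F_def \<mu>'_def algebra_simps)

  define X where "X \<mu> l \<omega> = real (card {s. s < m \<and> top_choice (\<omega> s) (stretched t p \<mu> s) = Some l})" for \<mu> l \<omega>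
  define Y where "Y \<mu> \<omega> = real (card {s. s < m \<and> hd (\<omega> s) \<in> stretched t p \<mu> s})" for \<mu> \<omega>
  define b where "b = exp (- 2 * d\<^sup>2 / m)"
  define B1 where "B1 l = {\<omega> \<in> space P. \<nu> \<mu> l + d \<le> X \<mu> l \<omega>}" for l
  define B2 where "B2 l = {\<omega> \<in> space P. X \<mu>' l \<omega> \<le> \<nu> \<mu>' l - d}" for l
  define B3 where "B3 = {\<omega> \<in> space P. Y \<mu> \<omega> \<le> h \<mu> - d}"
  define B4 where "B4 = {\<omega> \<in> space P. h \<mu>' + d \<le> Y \<mu>' \<omega>}"
  \<comment> \<open>The space contains sequences of arbitrary lists; those with an entry that is no
    ranking form a null set.\<close>
  define B5 where "B5 = {\<omega> \<in> space P. \<exists>s<m. set (\<omega> s) \<noteq> {..<p}}"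
  have B: "measure P (B1 l) \<le> b" "measure P (B2 l) \<le> b" "measure P B3 \<le> b" "measure P B4 \<le> b" for l
    unfolding B1_def B2_def B3_def B4_def b_def X_def Y_def h_def \<nu>_def share_def P_def
    using Hoeffding_card(1)[OF d(1) m, of L "\<lambda>s. {w. top_choice w (stretched t p \<mu> s) = Some l}"]
      Hoeffding_card(2)[OF d(1) m, of L "\<lambda>s. {w. top_choice w (stretched t p \<mu>' s) = Some l}"]
      Hoeffding_card(2)[OF d(1) m, of L "\<lambda>s. {w. hd w \<in> stretched t p \<mu> s}"]
      Hoeffding_card(1)[OF d(1) m, of L "\<lambda>s. {w. hd w \<in> stretched t p \<mu>' s}"]
    by simp_all
  have "AE \<omega> in P. \<forall>s\<in>{..<m}. set (\<omega> s) = {..<p}"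
    unfolding P_def
    by (intro eventually_ball_finite ballI AE_PiM_component measure_pmf.prob_space_axioms)
      (auto simp: AE_measure_pmf_iff rank)
  then have "AE \<omega> in P. \<omega> \<notin> B5" by eventually_elim (auto simp: B5_def)
  moreover have "B5 \<in> P.events" by (rule sets) (auto simp: B5_def)
  ultimately have B5: "measure P B5 = 0" by (simp add: P.prob_eq_0)
  define Bad where "Bad = (\<Union>l<p. B1 l) \<union> ((\<Union>l<p. B2 l) \<union> (B3 \<union> (B4 \<union> B5)))"
  have ev: "B1 l \<in> P.events" "B2 l \<in> P.events" "B3 \<in> P.events" "B4 \<in> P.events" "B5 \<in> P.events" for l
    by (rule sets; auto simp: B1_def B2_def B3_def B4_def B5_def)+
  have "measure P (\<Union>l<p. B1 l) \<le> (\<Sum>l<p. measure P (B1 l))"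
    "measure P (\<Union>l<p. B2 l) \<le> (\<Sum>l<p. measure P (B2 l))"
    using ev by (intro P.finite_measure_subadditive_finite; auto)+
  moreover have "(\<Sum>l<p. measure P (B1 l)) \<le> (\<Sum>l<p. b)" "(\<Sum>l<p. measure P (B2 l)) \<le> (\<Sum>l<p. b)"
    by (intro sum_mono B)+
  moreover have "measure P Bad \<le> measure P (\<Union>l<p. B1 l) + (measure P (\<Union>l<p. B2 l) +
      (measure P B3 + (measure P B4 + measure P B5)))"
    unfolding Bad_def using ev
    by (intro order_trans[OF measure_Un_le] add_mono order.refl sets.Un sets.finite_UN) auto
  ultimately have "measure P Bad \<le> (2 * real p + 2) * b"
    using B(3,4) B5 by (simp add: algebra_simps)
  moreover have "space P - Bad \<subseteq> ?Good"
  proof (rule subsetI)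
    fix \<omega> assume \<omega>: "\<omega> \<in> space P - Bad"
    then have valid: "set (\<omega> s) = {..<p}" if "s < m" for s
      using that by (auto simp: Bad_def B5_def)
    have X: "X \<mu> l \<omega> < \<nu> \<mu> l + d" "\<nu> \<mu>' l - d < X \<mu>' l \<omega>" if "l < p" for l
      using \<omega> that by (auto simp: Bad_def B1_def B2_def not_le)
    have slow: "X \<mu> l \<omega> < c l" if "l < p" for l
      using X(1)[OF that] slow_mean[OF that] by linarith
    have fast: "c l \<le> X \<mu>' l \<omega>" if "l < p" "\<mu>' * real (t l) \<le> real m" for l
      using X(2)[OF that(1)] fast_mean[OF that] by linarith
    have Y: "h \<mu> - d < Y \<mu> \<omega>" "Y \<mu>' \<omega> < h \<mu>' + d"
      using \<omega> by (auto simp: Bad_def B3_def B4_def not_le)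
    define f where "f = card {s. s < m \<and> hd (\<omega> s) \<in> vacant c \<omega> s}"
    have "Y \<mu> \<omega> \<le> real f" "real f \<le> Y \<mu>' \<omega>"
      unfolding Y_def f_def using slow fast
      by (intro of_nat_mono first_choice_sandwich[OF valid p, where \<mu> = \<mu> and \<mu>' = \<mu>' and t = t];
          simp add: X_def)+
    \<comment> \<open>The deviation \<open>d\<close> is traded for a second multiple of \<epsilon>
      by \<open>dF\<close>; the summand 1 is the rounding in \<open>h_up\<close>.\<close>
    with Y h_low h_up dF have "(1 - 2 * \<epsilon>) * (\<alpha> * F) \<le> f" "f \<le> (1 + 2 * \<epsilon>) * (\<alpha> * F) + 1"
      by (simp_all add: algebra_simps)
    with valid \<omega> show "\<omega> \<in> ?Good" by (simp add: f_def)
  qed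
  then have "measure P (space P - Bad) \<le> measure P ?Good"
    by (intro P.finite_measure_mono sets) auto
  moreover have "measure P (space P - Bad) = 1 - measure P Bad"
    by (intro P.prob_compl sets) (auto simp: Bad_def B1_def B2_def B3_def B4_def B5_def)
  ultimately show ?thesis by (simp add: b_def)
qed

section \<open>Uniformly random groups\<close>

lemma sum_permutes_comp_left:
  assumes "\<tau> permutes A"
  shows "(\<Sum>\<pi> | \<pi> permutes A. f (\<tau> \<circ> \<pi>)) = (\<Sum>\<pi> | \<pi> permutes A. f \<pi>)"
  by (rule sum.reindex_bij_witness[of _ "\<lambda>\<pi>. inv \<tau> \<circ> \<pi>" "\<lambda>\<pi>. \<tau> \<circ> \<pi>"])
    (use assms in \<open>auto simp: permutes_compose permutes_inv o_assoc permutes_inv_o\<close>)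

lemma sum_permutes_comp_right:
  assumes "\<tau> permutes A"
  shows "(\<Sum>\<pi> | \<pi> permutes A. f (\<pi> \<circ> \<tau>)) = (\<Sum>\<pi> | \<pi> permutes A. f \<pi>)"
  by (rule sum.reindex_bij_witness[of _ "\<lambda>\<pi>. \<pi> \<circ> inv \<tau>" "\<lambda>\<pi>. \<pi> \<circ> \<tau>"])
    (use assms in \<open>auto simp: permutes_compose permutes_inv comp_assoc permutes_inv_o\<close>)

text \<open>The positions \<open>A\<close> of a group stay fixed and a uniform permutation decides
  which candidates occupy them; \<open>hits\<close> is then hypergeometric. Expectations are written
  as sums over permutations, so \<open>fact n\<close> stands for total mass 1.\<close>

locale random_group =
  fixes n :: nat and S A :: "nat set"
  assumes S: "S \<subseteq> {..<n}" and A: "A \<subseteq> {..<n}" and n: "0 < n"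
begin

abbreviation perms :: "(nat \<Rightarrow> nat) set" where "perms \<equiv> {\<pi>. \<pi> permutes {..<n}}"

definition hits :: "(nat \<Rightarrow> nat) \<Rightarrow> nat" where "hits \<pi> = card {j \<in> A. \<pi> j \<in> S}"

definition hit :: "(nat \<Rightarrow> nat) \<Rightarrow> nat \<Rightarrow> real" where "hit \<pi> j = of_bool (\<pi> j \<in> S)"

lemma fin: "finite S" "finite A"
  using S A by (auto intro: finite_subset)

lemma card_perms: "card perms = fact n"
  by (simp add: card_permutations)

lemma hits_eq_sum: "real (hits \<pi>) = (\<Sum>j\<in>A. hit \<pi> j)"
  using fin by (simp add: hits_def hit_def Int_def)

lemma sum_hit: "\<pi> \<in> perms \<Longrightarrow> (\<Sum>j<n. hit \<pi> j) = card S"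
proof -
  assume "\<pi> \<in> perms"
  then have \<pi>: "\<pi> permutes {..<n}" by simp
  have "(\<Sum>j<n. hit \<pi> j) = (\<Sum>i<n. of_bool (i \<in> S))"
    unfolding hit_def by (rule sum.permute[OF \<pi>, of "\<lambda>i. of_bool (i \<in> S)", unfolded comp_def, symmetric])
  then show ?thesis using S by (simp add: Int_absorb1)
qed

text \<open>Transpositions show that all positions are hit equally often, and every permutation hits
  \<open>card S\<close> positions.\<close>

lemma sum_perms_hit:
  assumes "j < n"
  shows "real n * (\<Sum>\<pi>\<in>perms. hit \<pi> j) = fact n * card S"
proof -
  have "(\<Sum>\<pi>\<in>perms. hit \<pi> j') = (\<Sum>\<pi>\<in>perms. hit \<pi> j)" if "j' < n" for j'
    using sum_permutes_comp_right[of "Transposition.transpose j j'" "{..<n}" "\<lambda>\<pi>. hit \<pi> j"] that assms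
    by (simp add: hit_def permutes_swap_id)
  then have "real n * (\<Sum>\<pi>\<in>perms. hit \<pi> j) = (\<Sum>j'<n. \<Sum>\<pi>\<in>perms. hit \<pi> j')"
    by simp
  also have "\<dots> = (\<Sum>\<pi>\<in>perms. \<Sum>j'<n. hit \<pi> j')"
    by (rule sum.swap)
  also have "\<dots> = fact n * card S"
    by (simp add: sum_hit card_perms)
  finally show ?thesis .
qed

text \<open>Given a hit at \<open>j\<close>, the other \<open>card S\<close> - 1 hits are spread
  evenly over the other \<open>n\<close> - 1 positions.\<close>

lemma sum_perms_hit_hit:
  assumes "j < n" "j' < n" "j \<noteq> j'"
  shows "real n * ((real n - 1) * (\<Sum>\<pi>\<in>perms. hit \<pi> j * hit \<pi> j')) = fact n * card S * (real (card S) - 1)"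
proof -
  have "(\<Sum>\<pi>\<in>perms. hit \<pi> j * hit \<pi> i) = (\<Sum>\<pi>\<in>perms. hit \<pi> j * hit \<pi> j')" if "i \<in> {..<n} - {j}" for i
    using sum_permutes_comp_right[of "Transposition.transpose j' i" "{..<n}" "\<lambda>\<pi>. hit \<pi> j * hit \<pi> j'"] that assms
    by (simp add: hit_def permutes_swap_id Transposition.transpose_def)
  then have "(\<Sum>i\<in>{..<n} - {j}. \<Sum>\<pi>\<in>perms. hit \<pi> j * hit \<pi> i) =
      (\<Sum>i\<in>{..<n} - {j}. \<Sum>\<pi>\<in>perms. hit \<pi> j * hit \<pi> j')"
    by (rule sum.cong[OF refl])
  also have "\<dots> = (real n - 1) * (\<Sum>\<pi>\<in>perms. hit \<pi> j * hit \<pi> j')"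
    using assms by (simp add: of_nat_diff)
  finally have "(real n - 1) * (\<Sum>\<pi>\<in>perms. hit \<pi> j * hit \<pi> j') =
      (\<Sum>\<pi>\<in>perms. hit \<pi> j * (\<Sum>i\<in>{..<n} - {j}. hit \<pi> i))"
    by (subst (asm) sum.swap) (simp add: sum_distrib_left)
  also have "\<dots> = (\<Sum>\<pi>\<in>perms. hit \<pi> j * (real (card S) - 1))"
  proof (rule sum.cong[OF refl])
    fix \<pi> assume "\<pi> \<in> perms"
    then show "hit \<pi> j * (\<Sum>i\<in>{..<n} - {j}. hit \<pi> i) = hit \<pi> j * (real (card S) - 1)"
      using sum_hit[of \<pi>] assms(1) by (subst sum_diff1) (auto simp: hit_def)
  qed
  finally have "real n * ((real n - 1) * (\<Sum>\<pi>\<in>perms. hit \<pi> j * hit \<pi> j')) =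
      (real n * (\<Sum>\<pi>\<in>perms. hit \<pi> j)) * (real (card S) - 1)"
    by (simp add: sum_distrib_right)
  then show ?thesis by (simp only: sum_perms_hit[OF assms(1)])
qed

lemma sum_perms_hits: "(\<Sum>\<pi>\<in>perms. real (hits \<pi>)) = fact n * (card S * card A / n)"
proof -
  have "(\<Sum>\<pi>\<in>perms. real (hits \<pi>)) = (\<Sum>j\<in>A. \<Sum>\<pi>\<in>perms. hit \<pi> j)"
    unfolding hits_eq_sum by (rule sum.swap)
  also have "\<dots> = (\<Sum>j\<in>A. fact n * (card S / n))"
    using sum_perms_hit A n by (intro sum.cong[OF refl]) (auto simp: field_simps)
  finally show ?thesis by simp
qed

text \<open>Sampling without replacement is negatively correlated, as (K - 1) / (n - 1) \<le> K / n.
  Off-diagonal terms are bounded as if independent, so the variance is at most the mean.\<close>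

lemma sum_perms_hits_square:
  "(\<Sum>\<pi>\<in>perms. (real (hits \<pi>))\<^sup>2) \<le> fact n * (card S * card A / n + (card S * card A / n)\<^sup>2)"
proof -
  have "(\<Sum>\<pi>\<in>perms. (real (hits \<pi>))\<^sup>2) = (\<Sum>j\<in>A. \<Sum>i\<in>A. \<Sum>\<pi>\<in>perms. hit \<pi> j * hit \<pi> i)"
    unfolding hits_eq_sum power2_eq_square sum_product
    by (subst sum.swap, rule sum.cong[OF refl], rule sum.swap)
  also have "\<dots> \<le> (\<Sum>j\<in>A. \<Sum>i\<in>A. (if i = j then fact n * (card S / n) else 0) + fact n * (card S / n)\<^sup>2)"
  proof (intro sum_mono)
    fix j i assume ji: "j \<in> A" "i \<in> A"
    then have lt: "j < n" "i < n" using A by auto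
    show "(\<Sum>\<pi>\<in>perms. hit \<pi> j * hit \<pi> i) \<le>
        (if i = j then fact n * (card S / n) else 0) + fact n * (card S / n)\<^sup>2"
    proof (cases "i = j")
      case True
      have "(\<Sum>\<pi>\<in>perms. hit \<pi> j * hit \<pi> j) = (\<Sum>\<pi>\<in>perms. hit \<pi> j)"
        by (intro sum.cong) (auto simp: hit_def)
      also have "\<dots> = fact n * (card S / n)"
        using sum_perms_hit[OF lt(1)] n by (simp add: field_simps)
      finally show ?thesis using True by simp
    next
      case False
      with lt have n1: "1 < real n" by auto
      have "card S \<le> n" using card_mono[OF _ S] by simp
      then have "(real (card S) - 1) / (real n - 1) \<le> card S / n"
        using n1 by (simp add: field_simps)
      then have "fact n * (card S / n) * ((real (card S) - 1) / (real n - 1)) \<le>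
          fact n * (card S / n) * (card S / n)"
        by (intro mult_left_mono) auto
      moreover have "(\<Sum>\<pi>\<in>perms. hit \<pi> j * hit \<pi> i) =
          fact n * (card S / n) * ((real (card S) - 1) / (real n - 1))"
        using sum_perms_hit_hit[OF lt] False n1 by (simp add: field_simps)
      ultimately show ?thesis using False by (simp add: power2_eq_square)
    qed
  qed
  also have "\<dots> = fact n * (card S * card A / n + (card S * card A / n)\<^sup>2)"
    using fin by (simp add: sum.distrib sum.delta algebra_simps power2_eq_square)
  finally show ?thesis .
qed

lemma sum_perms_hits_deviation:
  assumes "S \<noteq> {}"
  shows "(\<Sum>\<pi>\<in>perms. \<bar>real (hits \<pi>) - card S * card A / n\<bar>) \<le> fact n * sqrt (card S)"
proof -
  define K where "K = real (card S)"
  define x where "x = card S * card A / n"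
  have K: "0 < K" using assms fin by (simp add: K_def card_gt_0_iff)
  have "card A \<le> n" using card_mono[OF _ A] by simp
  then have xK: "x \<le> K" using n K by (simp add: x_def K_def field_simps)
  have "(\<Sum>\<pi>\<in>perms. (real (hits \<pi>) - x)\<^sup>2) =
      (\<Sum>\<pi>\<in>perms. (real (hits \<pi>))\<^sup>2) - 2 * x * (\<Sum>\<pi>\<in>perms. real (hits \<pi>)) + fact n * x\<^sup>2"
    by (simp add: power2_diff sum.distrib sum_subtractf card_perms sum_distrib_left algebra_simps)
  also have "\<dots> \<le> fact n * (x + x\<^sup>2) - 2 * x * (fact n * x) + fact n * x\<^sup>2"
    using sum_perms_hits_square by (simp add: sum_perms_hits x_def)
  also have "\<dots> = fact n * x" by (simp add: algebra_simps power2_eq_square)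
  also have "\<dots> \<le> fact n * K" using xK by simp
  finally have sq: "(\<Sum>\<pi>\<in>perms. (real (hits \<pi>) - x)\<^sup>2) \<le> fact n * K" .
  \<comment> \<open>The arithmetic-geometric mean inequality with scale sqrt K takes the place of
    Cauchy-Schwarz; this scale suits a variance of at most K.\<close>
  have "\<bar>y\<bar> \<le> (y\<^sup>2 / sqrt K + sqrt K) / 2" for y :: real
  proof -
    have "0 \<le> (\<bar>y\<bar> - sqrt K)\<^sup>2" by simp
    then show ?thesis using K by (simp add: power2_diff field_simps)
  qed
  then have "(\<Sum>\<pi>\<in>perms. \<bar>real (hits \<pi>) - x\<bar>) \<le>
      (\<Sum>\<pi>\<in>perms. ((real (hits \<pi>) - x)\<^sup>2 / sqrt K + sqrt K) / 2)"
    by (intro sum_mono)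
  also have "\<dots> = ((\<Sum>\<pi>\<in>perms. (real (hits \<pi>) - x)\<^sup>2) / sqrt K + fact n * sqrt K) / 2"
    by (simp add: sum_divide_distrib[symmetric] sum.distrib card_perms)
  also have "\<dots> \<le> (fact n * K / sqrt K + fact n * sqrt K) / 2"
    using sq K by (intro divide_right_mono add_right_mono) auto
  also have "\<dots> = fact n * sqrt K" using K by (simp add: real_div_sqrt flip: times_divide_eq_right)
  finally show ?thesis by (simp add: x_def K_def)
qed

text \<open>Swapping two elements of \<open>S\<close> preserves the number of hits, so all of \<open>S\<close> is weighted equally.\<close>

lemma sum_perms_weighted_hits:
  fixes u :: "nat \<Rightarrow> real" and \<phi> :: "nat \<Rightarrow> real"
  shows "card S * (\<Sum>\<pi>\<in>perms. \<phi> (hits \<pi>) * (\<Sum>j | j \<in> A \<and> \<pi> j \<in> S. u (\<pi> j))) =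
    (\<Sum>i\<in>S. u i) * (\<Sum>\<pi>\<in>perms. \<phi> (hits \<pi>) * hits \<pi>)"
proof -
  \<comment> \<open>\<open>W i\<close> is the weighted frequency with which candidate
    \<open>i\<close> lands in the group; the factor \<phi> sees only the number of hits and so
    cannot distinguish elements of \<open>S\<close>.\<close>
  define W where "W i = (\<Sum>\<pi>\<in>perms. \<phi> (hits \<pi>) * of_bool (i \<in> \<pi> ` A))" for i
  have W: "W i = W i'" if i: "i \<in> S" "i' \<in> S" for i i'
  proof -
    let ?\<tau> = "Transposition.transpose i i'"
    have "?\<tau> permutes {..<n}" using i S by (intro permutes_swap_id) auto
    then have "W i = (\<Sum>\<pi>\<in>perms. \<phi> (hits (?\<tau> \<circ> \<pi>)) * of_bool (i \<in> (?\<tau> \<circ> \<pi>) ` A))"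
      unfolding W_def by (rule sum_permutes_comp_left[symmetric])
    also have "\<dots> = W i'"
    proof -
      have "?\<tau> x \<in> S \<longleftrightarrow> x \<in> S" for x using i by (auto simp: Transposition.transpose_def)
      then have "hits (?\<tau> \<circ> \<pi>) = hits \<pi>" for \<pi> by (simp add: hits_def)
      moreover have "i \<in> (?\<tau> \<circ> \<pi>) ` A \<longleftrightarrow> i' \<in> \<pi> ` A" for \<pi>
      proof -
        have "i \<in> ?\<tau> ` B \<longleftrightarrow> i' \<in> B" for B
          by (metis (no_types, lifting) image_iff transpose_apply_second transpose_involutory)
        then show ?thesis unfolding image_comp[symmetric] by blast
      qed
      ultimately show ?thesis by (simp add: W_def)
    qed
    finally show ?thesis .
  qed
  have inner: "(\<Sum>j | j \<in> A \<and> \<pi> j \<in> S. f (\<pi> j)) = (\<Sum>i\<in>S. f i * of_bool (i \<in> \<pi> ` A))"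
    if "\<pi> \<in> perms" for \<pi> and f :: "nat \<Rightarrow> real"
  proof -
    have "inj \<pi>" using that permutes_inj by blast
    then have "(\<Sum>j | j \<in> A \<and> \<pi> j \<in> S. f (\<pi> j)) = (\<Sum>i\<in>\<pi> ` {j. j \<in> A \<and> \<pi> j \<in> S}. f i)"
      by (subst sum.reindex) (auto intro: inj_on_subset)
    also have "\<pi> ` {j. j \<in> A \<and> \<pi> j \<in> S} = S \<inter> \<pi> ` A" by auto
    also have "(\<Sum>i\<in>S \<inter> \<pi> ` A. f i) = (\<Sum>i\<in>S. f i * of_bool (i \<in> \<pi> ` A))"
      using fin(1) by simp
    finally show ?thesis .
  qed
  have weighted: "(\<Sum>\<pi>\<in>perms. \<phi> (hits \<pi>) * (\<Sum>j | j \<in> A \<and> \<pi> j \<in> S. f (\<pi> j))) = (\<Sum>i\<in>S. f i * W i)"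
    for f :: "nat \<Rightarrow> real"
  proof -
    have "(\<Sum>\<pi>\<in>perms. \<phi> (hits \<pi>) * (\<Sum>j | j \<in> A \<and> \<pi> j \<in> S. f (\<pi> j))) =
        (\<Sum>\<pi>\<in>perms. \<Sum>i\<in>S. f i * (\<phi> (hits \<pi>) * of_bool (i \<in> \<pi> ` A)))"
      by (intro sum.cong[OF refl]) (simp only: inner sum_distrib_left mult_ac)
    also have "\<dots> = (\<Sum>i\<in>S. f i * W i)"
      unfolding W_def by (subst sum.swap) (simp only: sum_distrib_left)
    finally show ?thesis .
  qed
  have "card S * (\<Sum>i\<in>S. u i * W i) = (\<Sum>i\<in>S. u i) * (\<Sum>i\<in>S. W i)"
  proof (cases "S = {}")
    case False
    then obtain i0 where i0: "i0 \<in> S" by auto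
    have "(\<Sum>i\<in>S. u i * W i) = (\<Sum>i\<in>S. u i * W i0)"
      by (rule sum.cong[OF refl]) (metis W i0)
    moreover have "(\<Sum>i\<in>S. W i) = (\<Sum>i\<in>S. W i0)"
      by (rule sum.cong[OF refl]) (metis W i0)
    ultimately show ?thesis by (simp flip: sum_distrib_right)
  qed simp
  moreover have "(\<Sum>\<pi>\<in>perms. \<phi> (hits \<pi>) * hits \<pi>) = (\<Sum>i\<in>S. W i)"
    using weighted[of "\<lambda>_. 1"] by (simp add: hits_def)
  ultimately show ?thesis by (simp add: weighted)
qed

end

section \<open>Utility of the selected candidates\<close>

lemma sorted_candidate_order: "sorted (map (\<lambda>i. - v i) (candidate_order S v))"
  by (simp add: candidate_order_def)

lemma candidate_order_take_ge:
  assumes "finite S" "i \<in> set (take m (candidate_order S v))" "j \<in> S - set (take m (candidate_order S v))"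
  shows "v j \<le> v i"
proof -
  let ?xs = "candidate_order S v"
  from assms(2) obtain a where a: "a < m" "a < length ?xs" "i = ?xs ! a"
    by (auto simp: in_set_conv_nth)
  have "j \<in> set ?xs" using assms by (simp add: candidate_order_def)
  then obtain b where b: "b < length ?xs" "j = ?xs ! b"
    by (auto simp: in_set_conv_nth)
  have "m \<le> b"
  proof (rule ccontr)
    assume "\<not> m \<le> b"
    then have "j \<in> set (take m ?xs)" using b by (auto simp: in_set_conv_nth)
    then show False using assms(3) by simp
  qed
  then have "map (\<lambda>i. - v i) ?xs ! a \<le> map (\<lambda>i. - v i) ?xs ! b"
    using a b by (intro sorted_nth_mono[OF sorted_candidate_order]) auto
  then show ?thesis using a b by simp
qed

text \<open>A threshold \<theta> separates the selected from the rest. The excess over \<theta>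
  summed over \<open>Y\<close> is at most that over the selected set, and the part \<theta> per
  element is paid for because the scaled size of \<open>Y\<close> is at most
  \<open>m\<close>.\<close>

lemma sum_top_ge:
  fixes u v :: "nat \<Rightarrow> real"
  assumes G: "finite G" and m: "m \<le> card G" and Y: "Y \<subseteq> G"
    and nonneg: "\<And>i. i \<in> G \<Longrightarrow> 0 \<le> u i"
    and order: "\<And>i j. i \<in> G \<Longrightarrow> j \<in> G \<Longrightarrow> v j \<le> v i \<Longrightarrow> u j \<le> u i"
  shows "min 1 (m / card Y) * (\<Sum>i\<in>Y. u i) \<le> (\<Sum>i\<in>set (take m (candidate_order G v)). u i)"
proof -
  define T where "T = set (take m (candidate_order G v))"
  have T: "T \<subseteq> G" "card T = m"
    using G m by (auto simp: T_def candidate_order_def dest: in_set_takeD intro!: distinct_card[THEN trans] distinct_take)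
  have fin: "finite T" "finite Y" using G T Y by (auto intro: finite_subset)
  have ge: "u j \<le> u i" if "i \<in> T" "j \<in> G - T" for i j
    using that T candidate_order_take_ge[OF G, of i m v j] by (intro order) (auto simp: T_def)
  obtain \<theta> where \<theta>: "0 \<le> \<theta>" "\<And>j. j \<in> G - T \<Longrightarrow> u j \<le> \<theta>" "\<And>i. i \<in> T \<Longrightarrow> \<theta> \<le> u i"
  proof (cases "G - T = {}")
    case True
    then show ?thesis using nonneg T by (intro that[of 0]) auto
  next
    case False
    let ?\<theta> = "Max (u ` (G - T))"
    have "?\<theta> \<in> u ` (G - T)" using False G by (intro Max_in) auto
    then obtain j0 where "j0 \<in> G - T" "?\<theta> = u j0" by auto
    moreover have "u j \<le> ?\<theta>" if "j \<in> G - T" for j using that G by (intro Max_ge) auto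
    ultimately show ?thesis using nonneg ge by (intro that[of ?\<theta>]) auto
  qed
  define c where "c = min 1 (m / card Y)"
  \<comment> \<open>For empty \<open>Y\<close> division by zero gives \<open>c\<close> = 0,
    consistent with the empty sum.\<close>
  have c: "0 \<le> c" "c \<le> 1" "c * card Y \<le> m" by (auto simp: c_def min_def field_simps)
  define w where "w i = u i - \<theta>" for i
  have wT: "0 \<le> (\<Sum>i\<in>T. w i)" using \<theta>(3) by (intro sum_nonneg) (auto simp: w_def)
  have "(\<Sum>i\<in>Y. w i) \<le> (\<Sum>i\<in>Y. if i \<in> T then w i else 0)"
    using Y \<theta>(2) by (intro sum_mono) (auto simp: w_def)
  also have "\<dots> = (\<Sum>i\<in>Y \<inter> T. w i)"
    using fin by (simp add: sum.inter_restrict)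
  also have "\<dots> \<le> (\<Sum>i\<in>T. w i)"
    using fin \<theta>(3) by (intro sum_mono2) (auto simp: w_def)
  finally have "(\<Sum>i\<in>Y. u i) \<le> \<theta> * card Y + (\<Sum>i\<in>T. w i)"
    by (simp add: w_def sum_subtractf algebra_simps)
  then have "c * (\<Sum>i\<in>Y. u i) \<le> c * (\<theta> * card Y + (\<Sum>i\<in>T. w i))"
    using c by (intro mult_left_mono) auto
  also have "\<dots> = \<theta> * (c * card Y) + c * (\<Sum>i\<in>T. w i)" by (simp add: algebra_simps)
  also have "\<dots> \<le> \<theta> * m + 1 * (\<Sum>i\<in>T. w i)"
    using c wT \<theta>(1) by (intro add_mono mult_left_mono mult_right_mono) auto
  also have "\<dots> = (\<Sum>i\<in>T. u i)" using T(2) by (simp add: w_def sum_subtractf)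
  finally show ?thesis by (simp add: c_def T_def)
qed

lemma optimal_utility_eq:
  "optimal_utility n K u = (\<Sum>i\<in>set (take K (candidate_order {..<n} u)). u i)"
proof -
  let ?xs = "candidate_order {..<n} u"
  have "sort (map u [0..<n]) = rev (map u ?xs)"
  proof (rule properties_for_sort)
    show "mset (rev (map u ?xs)) = mset (map u [0..<n])"
      by (simp add: candidate_order_def lessThan_atLeast0)
    have "sorted_wrt (\<lambda>i j. - u i \<le> - u j) ?xs"
      using sorted_candidate_order[of u "{..<n}"] by (simp add: sorted_wrt_map)
    then show "sorted (rev (map u ?xs))"
      by (simp add: sorted_wrt_rev sorted_wrt_map)
  qed
  then show ?thesis
    by (simp add: optimal_utility_def take_map candidate_order_def sum_list_distinct_conv_sum_set)
qed

lemma optimal_utility_permute: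
  assumes "\<pi> permutes {..<n}" "\<And>i. i < n \<Longrightarrow> v i = u (\<pi> i)"
  shows "optimal_utility n K v = optimal_utility n K u"
proof -
  have "mset (map v [0..<n]) = image_mset u (image_mset \<pi> (mset_set {..<n}))"
    using assms(2) by (auto simp: lessThan_atLeast0 multiset.map_comp intro!: image_mset_cong)
  also have "image_mset \<pi> (mset_set {..<n}) = mset_set {..<n}"
    using assms(1) by (simp add: image_mset_mset_set permutes_inj_on permutes_image)
  finally have "mset (map v [0..<n]) = mset (map u [0..<n])"
    by (simp add: lessThan_atLeast0)
  then have "sort (map v [0..<n]) = sort (map u [0..<n])"
    by (metis properties_for_sort sorted_sort mset_sort)
  then show ?thesis by (simp add: optimal_utility_def)
qed

text \<open>Utilities are frozen and only their allocation to candidates is permuted.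
  \<open>S\<close> holds the K best values; a group hitting \<open>S\<close> in X places keeps at
  least the fraction min (1, m / X) of what it hit, and by symmetry each element of \<open>S\<close>
  contributes equally to what is kept on average.\<close>

lemma average_group_utility:
  fixes u :: "nat \<Rightarrow> real" and T :: "(nat \<Rightarrow> nat) \<Rightarrow> nat set"
  assumes n: "0 < n" and G: "G\<^sub>1 \<union> G\<^sub>2 = {..<n}" "G\<^sub>1 \<inter> G\<^sub>2 = {}"
    and K: "0 < K" "K \<le> n"
    and m1: "real m1 = K * card G\<^sub>1 / n" and m2: "real m2 = K * card G\<^sub>2 / n"
    and nonneg: "\<And>i. i < n \<Longrightarrow> 0 \<le> u i"
    and v: "\<And>\<pi> i. i \<in> G\<^sub>1 \<Longrightarrow> v \<pi> i = u (\<pi> i)" "\<And>\<pi> i. i \<in> G\<^sub>2 \<Longrightarrow> v \<pi> i = \<beta> * u (\<pi> i)" "0 < \<beta>"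
    and T: "\<And>\<pi>. T \<pi> = set (take m1 (candidate_order G\<^sub>1 (v \<pi>))) \<union> set (take m2 (candidate_order G\<^sub>2 (v \<pi>)))"
  shows "(1 - 1 / sqrt K) * optimal_utility n K u * fact n \<le>
     (\<Sum>\<pi> | \<pi> permutes {..<n}. \<Sum>i\<in>T \<pi>. u (\<pi> i))"
proof -
  define S where "S = set (take K (candidate_order {..<n} u))"
  have S: "S \<subseteq> {..<n}" "card S = K"
    using K by (auto simp: S_def candidate_order_def dest: in_set_takeD intro!: distinct_card[THEN trans] distinct_take)
  have opt: "optimal_utility n K u = (\<Sum>i\<in>S. u i)"
    by (simp add: optimal_utility_eq S_def)
  have sub: "G\<^sub>1 \<subseteq> {..<n}" "G\<^sub>2 \<subseteq> {..<n}" using G by auto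
  then have fin: "finite G\<^sub>1" "finite G\<^sub>2" by (auto intro: finite_subset)
  interpret g1: random_group n S G\<^sub>1 using S sub n by unfold_locales auto
  interpret g2: random_group n S G\<^sub>2 using S sub n by unfold_locales auto
  have "card G\<^sub>1 + card G\<^sub>2 = n"
    using card_Un_disjoint[OF fin G(2)] G(1) by simp
  then have "real (card G\<^sub>1) + real (card G\<^sub>2) = n" by linarith
  then have m_sum: "real m1 + real m2 = K"
    using n by (simp add: m1 m2 flip: add_divide_distrib distrib_left)
  have mle: "m1 \<le> card G\<^sub>1" "m2 \<le> card G\<^sub>2"
  proof -
    have le: "real (K * card G) / real n \<le> card G" for G :: "nat set"
      using K n mult_right_mono[of "real K" "real n" "real (card G)"]
      by (simp add: pos_divide_le_eq mult.commute)
    have "real m1 \<le> card G\<^sub>1" "real m2 \<le> card G\<^sub>2"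
      unfolding m1 m2 by (rule le)+
    then show "m1 \<le> card G\<^sub>1" "m2 \<le> card G\<^sub>2" by simp_all
  qed
  \<comment> \<open>The guaranteed fraction of the hits' utility when \<open>x\<close> hits compete
    for \<open>m\<close> slots.\<close>
  define \<phi> where "\<phi> m x = min 1 (real m / real x)" for m x :: nat
  have \<phi>: "\<phi> m x * real x = min (real m) (real x)" for m x
    by (cases "x = 0") (auto simp: \<phi>_def min_def field_simps)
  have summand: "\<phi> m1 (g1.hits \<pi>) * (\<Sum>j | j \<in> G\<^sub>1 \<and> \<pi> j \<in> S. u (\<pi> j)) +
      \<phi> m2 (g2.hits \<pi>) * (\<Sum>j | j \<in> G\<^sub>2 \<and> \<pi> j \<in> S. u (\<pi> j)) \<le> (\<Sum>i\<in>T \<pi>. u (\<pi> i))"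
    if \<pi>: "\<pi> permutes {..<n}" for \<pi>
  proof -
    have pos: "0 \<le> u (\<pi> i)" if "i < n" for i
      using nonneg permutes_in_image[OF \<pi>, of i] that by auto
    have "\<phi> m1 (g1.hits \<pi>) * (\<Sum>j | j \<in> G\<^sub>1 \<and> \<pi> j \<in> S. u (\<pi> j)) \<le>
        (\<Sum>i\<in>set (take m1 (candidate_order G\<^sub>1 (v \<pi>))). u (\<pi> i))"
      unfolding \<phi>_def g1.hits_def using pos sub v
      by (intro sum_top_ge fin mle) auto
    moreover have "\<phi> m2 (g2.hits \<pi>) * (\<Sum>j | j \<in> G\<^sub>2 \<and> \<pi> j \<in> S. u (\<pi> j)) \<le>
        (\<Sum>i\<in>set (take m2 (candidate_order G\<^sub>2 (v \<pi>))). u (\<pi> i))"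
      unfolding \<phi>_def g2.hits_def using pos sub v
      by (intro sum_top_ge fin mle) auto
    moreover have "(\<Sum>i\<in>T \<pi>. u (\<pi> i)) = (\<Sum>i\<in>set (take m1 (candidate_order G\<^sub>1 (v \<pi>))). u (\<pi> i)) +
        (\<Sum>i\<in>set (take m2 (candidate_order G\<^sub>2 (v \<pi>))). u (\<pi> i))"
      unfolding T using G(2) fin
      by (intro sum.union_disjoint) (auto simp: candidate_order_def dest!: in_set_takeD)
    ultimately show ?thesis by simp
  qed
  \<comment> \<open>Both the hits and the slots of the two groups add up to K, so an excess in one
    group is an equal deficit in the other and is lost only once.\<close>
  have hits: "\<phi> m1 (g1.hits \<pi>) * g1.hits \<pi> + \<phi> m2 (g2.hits \<pi>) * g2.hits \<pi> =
      K - \<bar>real (g1.hits \<pi>) - m1\<bar>" if \<pi>: "\<pi> permutes {..<n}" for \<pi>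
  proof -
    have "(\<Sum>j<n. g1.hit \<pi> j) = (\<Sum>j\<in>G\<^sub>1. g1.hit \<pi> j) + (\<Sum>j\<in>G\<^sub>2. g1.hit \<pi> j)"
      unfolding G(1)[symmetric] by (rule sum.union_disjoint[OF fin G(2)])
    then have "real (g1.hits \<pi>) + real (g2.hits \<pi>) = K"
      using g1.sum_hit[of \<pi>] \<pi> S(2) by (simp add: g1.hits_eq_sum g2.hits_eq_sum)
    then show ?thesis unfolding \<phi> using m_sum by linarith
  qed
  have dev: "(\<Sum>\<pi> | \<pi> permutes {..<n}. \<bar>real (g1.hits \<pi>) - m1\<bar>) \<le> fact n * sqrt K"
  proof -
    have "S \<noteq> {}" using S(2) K(1) by auto
    from g1.sum_perms_hits_deviation[OF this] show ?thesis by (simp add: S(2) m1)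
  qed
  have nonneg_opt: "0 \<le> (\<Sum>i\<in>S. u i)" using S nonneg by (intro sum_nonneg) auto
  have "real K * ((1 - 1 / sqrt K) * (\<Sum>i\<in>S. u i) * fact n) =
      (\<Sum>i\<in>S. u i) * (fact n * K - fact n * sqrt K)"
  proof -
    have "real K * (1 - 1 / sqrt K) = K - sqrt K" by (simp add: right_diff_distrib real_div_sqrt)
    then have "real K * (1 - 1 / sqrt K) * ((\<Sum>i\<in>S. u i) * fact n) = (K - sqrt K) * ((\<Sum>i\<in>S. u i) * fact n)"
      by (simp only:)
    then show ?thesis by (simp only: algebra_simps of_nat_mult of_nat_fact mult_1_left)
  qed
  also have "\<dots> \<le> (\<Sum>i\<in>S. u i) * (\<Sum>\<pi> | \<pi> permutes {..<n}. K - \<bar>real (g1.hits \<pi>) - m1\<bar>)"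
    using dev by (intro mult_left_mono nonneg_opt) (simp add: sum_subtractf g1.card_perms)
  also have "\<dots> = (\<Sum>i\<in>S. u i) * (\<Sum>\<pi> | \<pi> permutes {..<n}. \<phi> m1 (g1.hits \<pi>) * g1.hits \<pi>) +
      (\<Sum>i\<in>S. u i) * (\<Sum>\<pi> | \<pi> permutes {..<n}. \<phi> m2 (g2.hits \<pi>) * g2.hits \<pi>)"
    by (simp add: hits[symmetric] sum.distrib distrib_left)
  also have "\<dots> = K * (\<Sum>\<pi> | \<pi> permutes {..<n}.
      \<phi> m1 (g1.hits \<pi>) * (\<Sum>j | j \<in> G\<^sub>1 \<and> \<pi> j \<in> S. u (\<pi> j)) +
      \<phi> m2 (g2.hits \<pi>) * (\<Sum>j | j \<in> G\<^sub>2 \<and> \<pi> j \<in> S. u (\<pi> j)))"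
    by (simp add: g1.sum_perms_weighted_hits[symmetric] g2.sum_perms_weighted_hits[symmetric] S(2)
        sum.distrib distrib_left)
  also have "\<dots> \<le> K * (\<Sum>\<pi> | \<pi> permutes {..<n}. \<Sum>i\<in>T \<pi>. u (\<pi> i))"
    using summand by (intro mult_left_mono sum_mono) auto
  finally show ?thesis using K(1) by (simp add: opt)
qed

section \<open>Measurability\<close>

lemma measurable_insort_key:
  fixes f :: "'b :: countable \<Rightarrow> 'a \<Rightarrow> real"
  assumes [measurable]: "\<And>y. f y \<in> borel_measurable M"
  shows "(\<lambda>u. insort_key (\<lambda>i. f i u) x ys) \<in> M \<rightarrow>\<^sub>M count_space UNIV"
proof (induction ys)
  case (Cons y ys)
  then have [measurable]: "(\<lambda>u. y # insort_key (\<lambda>i. f i u) x ys) \<in> M \<rightarrow>\<^sub>M count_space UNIV"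
    by (rule measurable_compose) simp
  show ?case by simp
qed simp

text \<open>Lists over a countable type are countably many, so the recursion can be composed outcome
  by outcome.\<close>

lemma measurable_sort_key:
  fixes f :: "'b :: countable \<Rightarrow> 'a \<Rightarrow> real"
  assumes "\<And>y. f y \<in> borel_measurable M"
  shows "(\<lambda>u. sort_key (\<lambda>i. f i u) ys) \<in> M \<rightarrow>\<^sub>M count_space UNIV"
proof (induction ys)
  case (Cons y ys)
  from measurable_compose_countable[OF measurable_insort_key[OF assms] this]
  show ?case by (simp add: sort_key_def)
qed (simp add: sort_key_def)

lemma measurable_candidate_order:
  fixes f :: "nat \<Rightarrow> 'a \<Rightarrow> real"
  assumes [measurable]: "\<And>i. f i \<in> borel_measurable M"
  shows "(\<lambda>u. candidate_order S (\<lambda>i. f i u)) \<in> M \<rightarrow>\<^sub>M count_space UNIV"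
  unfolding candidate_order_def by (rule measurable_sort_key) measurable

lemma distr_pair_snd:
  assumes "prob_space M" "sigma_finite_measure N"
  shows "distr (M \<Otimes>\<^sub>M N) N snd = N"
proof (rule measure_eqI)
  interpret M: prob_space M by fact
  interpret N: sigma_finite_measure N by fact
  fix A assume "A \<in> sets (distr (M \<Otimes>\<^sub>M N) N snd)"
  then have A: "A \<in> sets N" by simp
  have "snd -` A \<inter> space (M \<Otimes>\<^sub>M N) = space M \<times> A"
    using sets.sets_into_space[OF A] by (auto simp: space_pair_measure)
  then show "emeasure (distr (M \<Otimes>\<^sub>M N) N snd) A = emeasure N A"
    using A by (simp add: emeasure_distr N.emeasure_pair_measure_Times M.emeasure_space_1)
qed simp

lemma min_max_ratio_nonneg: "0 \<le> x \<Longrightarrow> 0 \<le> y \<Longrightarrow> 0 \<le> min_max_ratio x y"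
  and min_max_ratio_le_1: "0 \<le> x \<Longrightarrow> 0 \<le> y \<Longrightarrow> min_max_ratio x y \<le> 1"
  by (auto simp: min_max_ratio_def divide_simps)

text \<open>This is (1 - 5 \<epsilon>) (1 + 3 \<epsilon>) \<le> 1 - 2 \<epsilon>; the difference is
  15 times the square of \<epsilon>.\<close>

lemma min_max_ratio_ge:
  assumes "0 < \<phi>" "0 \<le> \<epsilon>"
    and "(1 - 2 * \<epsilon>) * \<phi> \<le> x" "x \<le> (1 + 3 * \<epsilon>) * \<phi>"
    and "(1 - 2 * \<epsilon>) * \<phi> \<le> y" "y \<le> (1 + 3 * \<epsilon>) * \<phi>"
    and "5 * \<epsilon> \<le> 1"
  shows "1 - 5 * \<epsilon> \<le> min_max_ratio x y"
proof -
  have "0 < (1 - 2 * \<epsilon>) * \<phi>" using assms by (intro mult_pos_pos) auto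
  then have pos: "0 < max x y" using assms by linarith
  have "(1 - 5 * \<epsilon>) * max x y \<le> (1 - 5 * \<epsilon>) * ((1 + 3 * \<epsilon>) * \<phi>)"
    using assms by (intro mult_left_mono) auto
  also have "\<dots> = (1 - 2 * \<epsilon>) * \<phi> - 15 * \<epsilon>\<^sup>2 * \<phi>"
    by (simp add: algebra_simps power2_eq_square)
  also have "\<dots> \<le> (1 - 2 * \<epsilon>) * \<phi>" using assms by simp
  also have "\<dots> \<le> min x y" using assms by simp
  finally show ?thesis using pos by (simp add: min_max_ratio_def pos_le_divide_eq)
qed

section \<open>The probabilistic model\<close>

context selection_model
begin

abbreviation "utilities \<equiv> PiM {..<n} (\<lambda>_. D)"
abbreviation "preferences \<equiv> PiM {..<n} (\<lambda>_. measure_pmf L)"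

lemma prob_utilities_space: "prob_space utilities"
  and prob_preferences: "prob_space preferences"
  by (intro prob_space_PiM prob_utilities measure_pmf.prob_space_axioms)+

lemma population_eq: "population n D L = utilities \<Otimes>\<^sub>M preferences"
  by (simp add: population_def)

sublocale population: pair_prob_space utilities preferences
  using prob_utilities_space prob_preferences
  by (simp add: pair_prob_space_def pair_sigma_finite_def prob_space_imp_sigma_finite)

lemma set_ranking: "w \<in> set_pmf L \<Longrightarrow> set w = {..<p}"
  using rankings permutations_of_setD(1) by blast

lemma AE_ranking: "AE \<sigma> in preferences. \<forall>i\<in>{..<n}. set (\<sigma> i) = {..<p}"
  by (intro eventually_ball_finite ballI AE_PiM_component measure_pmf.prob_space_axioms)
    (auto simp: AE_measure_pmf_iff set_ranking)

lemma AE_nonneg: "AE u in utilities. \<forall>i\<in>{..<n}. 0 \<le> u i"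
  by (intro eventually_ball_finite ballI AE_PiM_component prob_utilities nonneg_utilities) auto

lemma AE_population_ranking: "AE x in population n D L. \<forall>i\<in>{..<n}. set (snd x i) = {..<p}"
proof (rule AE_distrD[where f = snd and M' = preferences and P = "\<lambda>\<sigma>. \<forall>i\<in>{..<n}. set (\<sigma> i) = {..<p}"])
  show "snd \<in> population n D L \<rightarrow>\<^sub>M preferences" by (simp add: population_eq)
  show "AE \<sigma> in distr (population n D L) preferences snd. \<forall>i\<in>{..<n}. set (\<sigma> i) = {..<p}"
    unfolding population_eq
    by (subst distr_pair_snd) (auto simp: prob_utilities_space AE_ranking intro: population.M2.sigma_finite_measure_axioms)
qed

lemma groups: "G\<^sub>1 \<subseteq> {..<n}" "G\<^sub>2 \<subseteq> {..<n}" "finite G\<^sub>1" "finite G\<^sub>2" "card G\<^sub>1 + card G\<^sub>2 = n"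
proof -
  show sub: "G\<^sub>1 \<subseteq> {..<n}" "G\<^sub>2 \<subseteq> {..<n}" using groups_cover by auto
  then show fin: "finite G\<^sub>1" "finite G\<^sub>2" by (auto intro: finite_subset)
  show "card G\<^sub>1 + card G\<^sub>2 = n"
    using card_Un_disjoint[OF fin groups_disjoint] groups_cover by simp
qed

lemma measurable_utility [measurable]: "(\<lambda>u. u i) \<in> borel_measurable utilities"
proof (cases "i < n")
  case True
  then have "(\<lambda>u. u i) \<in> utilities \<rightarrow>\<^sub>M D" by (intro measurable_component_singleton) auto
  then show ?thesis using measurable_cong_sets[OF refl borel_utilities] by blast
next
  case False
  \<comment> \<open>Points of the product space take the value \<open>undefined\<close> outside the
    index set.\<close>
  have "(\<lambda>u :: nat \<Rightarrow> real. undefined :: real) \<in> borel_measurable utilities" by simp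
  also have "?this \<longleftrightarrow> ?thesis"
    using False by (intro measurable_cong) (auto simp: space_PiM PiE_def extensional_def)
  finally show ?thesis .
qed

lemma measurable_order:
  "(\<lambda>u. candidate_order S (estimated_utility \<beta> G\<^sub>2 u)) \<in> utilities \<rightarrow>\<^sub>M count_space UNIV"
  unfolding estimated_utility_def by (rule measurable_candidate_order) measurable

lemma measurable_optimal_utility [measurable]:
  "optimal_utility n K \<in> borel_measurable utilities"
proof -
  have "(\<lambda>u. \<Sum>i\<in>set (take K xs). u i) \<in> borel_measurable utilities" for xs
    by measurable
  from measurable_compose_countable[OF this measurable_candidate_order[of "\<lambda>i u. u i"]]
  show ?thesis by (simp add: optimal_utility_eq[abs_def])
qed

abbreviation "inst_wise u \<sigma> \<equiv> alg_inst_wise n k G\<^sub>1 G\<^sub>2 (estimated_utility \<beta> G\<^sub>2 u) \<sigma>"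

text \<open>The assignment depends on the utilities only through the two candidate orders and on the
  preferences only through \<open>n\<close> lists. These range over countable types and can be
  frozen, which leaves a function of the utilities alone.\<close>

lemma measurable_inst_wise:
  assumes "\<And>M \<sigma>. \<Psi> M \<sigma> \<in> borel_measurable utilities"
  shows "(\<lambda>(u, \<sigma>). \<Psi> (inst_wise u \<sigma>) \<sigma> u :: real) \<in> borel_measurable (population n D L)"
proof -
  \<comment> \<open>Functions into lists are uncountable, so the preferences pass through a list of
    lists; extensionality of points of the product makes this lossless.\<close>
  define decode where "decode ws = (\<lambda>i\<in>{..<n}. ws ! i)" for ws :: "nat list list"
  define run where "run xs c ws = fold (assign_next c (decode ws)) xs Map.empty" for xs c ws
  define M where "M xs ys ws = run xs (\<lambda>l. k l * card G\<^sub>1 div n) ws ++ run ys (\<lambda>l. k l * card G\<^sub>2 div n) ws"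
    for xs ys ws
  define g where "g S x = candidate_order S (estimated_utility \<beta> G\<^sub>2 (fst x))"
    for S and x :: "(nat \<Rightarrow> real) \<times> (nat \<Rightarrow> nat list)"
  define lists where "lists x = map (snd x) [0..<n]" for x :: "(nat \<Rightarrow> real) \<times> (nat \<Rightarrow> nat list)"
  have g: "g S \<in> population n D L \<rightarrow>\<^sub>M count_space UNIV" for S
    unfolding g_def population_eq
    by (rule measurable_compose[OF measurable_fst measurable_order])
  have "(\<lambda>\<sigma>. map \<sigma> [0..<n]) \<in> preferences \<rightarrow>\<^sub>M count_space UNIV"
    by (simp add: measurable_PiM_measure_pmf)
  from measurable_compose[OF measurable_snd this]
  have lists: "lists \<in> population n D L \<rightarrow>\<^sub>M count_space UNIV"
    unfolding lists_def population_eq .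
  have "(\<lambda>x. \<Psi> (M xs ys ws) (decode ws) (fst x)) \<in> borel_measurable (population n D L)" for xs ys ws
    unfolding population_eq by (rule measurable_compose[OF measurable_fst assms])
  from measurable_compose_countable[OF this lists]
  have "(\<lambda>x. \<Psi> (M xs ys (lists x)) (decode (lists x)) (fst x)) \<in> borel_measurable (population n D L)" for xs ys .
  from measurable_compose_countable[OF this g]
  have "(\<lambda>x. \<Psi> (M xs (g G\<^sub>2 x) (lists x)) (decode (lists x)) (fst x)) \<in> borel_measurable (population n D L)" for xs .
  from measurable_compose_countable[OF this g]
  have "(\<lambda>x. \<Psi> (M (g G\<^sub>1 x) (g G\<^sub>2 x) (lists x)) (decode (lists x)) (fst x)) \<in> borel_measurable (population n D L)" .
  also have "?this \<longleftrightarrow> ?thesis"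
  proof (rule measurable_cong)
    fix x assume "x \<in> space (population n D L)"
    then obtain u \<sigma> where x: "x = (u, \<sigma>)" "\<sigma> \<in> extensional {..<n}"
      by (auto simp: population_eq space_pair_measure space_PiM PiE_def)
    have "decode (lists x) = \<sigma>"
      using x(2) by (auto simp: x(1) decode_def lists_def fun_eq_iff extensional_def)
    then show "\<Psi> (M (g G\<^sub>1 x) (g G\<^sub>2 x) (lists x)) (decode (lists x)) (fst x) =
        (case x of (u, \<sigma>) \<Rightarrow> \<Psi> (inst_wise u \<sigma>) \<sigma> u)"
      by (simp add: x(1) M_def run_def g_def alg_inst_wise_def alg_st_def)
  qed
  finally show ?thesis .
qed

text \<open>With \<open>v\<close> fixed the order of consideration is deterministic, and i.i.d.
  lists read along an injective order are again i.i.d. This is where independence of lists and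
  utilities enters.\<close>

lemma group_first_choice:
  fixes c t :: "nat \<Rightarrow> nat" and \<alpha> \<epsilon> d :: real and v :: "nat \<Rightarrow> real"
  assumes p: "0 < p"
    and t1: "\<And>l. l < p \<Longrightarrow> real (k l) \<le> (\<Sum>s<t l. share L (alive t p s) l)"
    and t2: "\<And>l. l < p \<Longrightarrow> (\<Sum>s<t l. share L (alive t p s) l) \<le> real (k l) + 1"
    and t3: "\<And>l. l < p \<Longrightarrow> t l \<le> (\<Sum>l<p. k l) + p"
    and alpha: "0 < \<alpha>" "\<alpha> \<le> 1" "\<And>l. l < p \<Longrightarrow> real (c l) = \<alpha> * real (k l)"
    and eps: "0 < \<epsilon>" "\<epsilon> < 1" and d: "0 \<le> d" "\<And>l. l < p \<Longrightarrow> d + 2 \<le> \<epsilon> * real (c l)"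
    and pK: "real p \<le> \<epsilon> * real (\<Sum>l<p. k l)"
  defines "m \<equiv> \<Sum>l<p. c l"
  defines "F \<equiv> \<Sum>l<p. measure_pmf.prob L {w. hd w = l} * real (t l)"
  assumes m: "0 < m" and dF: "d \<le> \<epsilon> * (\<alpha> * F)"
    and G: "G \<subseteq> {..<n}" "m \<le> card G"
  defines "f \<equiv> \<lambda>\<sigma>. real (card {i \<in> G. alg_st G c v \<sigma> i = Some (hd (\<sigma> i))})"
  shows "1 - (2 * real p + 2) * exp (- 2 * d\<^sup>2 / m) \<le>
    measure preferences {\<sigma> \<in> space preferences.
      (1 - 2 * \<epsilon>) * (\<alpha> * F) \<le> f \<sigma> \<and> f \<sigma> \<le> (1 + 2 * \<epsilon>) * (\<alpha> * F) + 1}"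
proof -
  have fin: "finite G" using G(1) by (rule finite_subset) simp
  let ?xs = "candidate_order G v"
  let ?P = "PiM {..<m} (\<lambda>_. measure_pmf L)"
  define proj where "proj \<sigma> = (\<lambda>s\<in>{..<m}. \<sigma> (?xs ! s))" for \<sigma> :: "nat \<Rightarrow> nat list"
  define Good where "Good = {\<omega> \<in> space ?P. (\<forall>s<m. set (\<omega> s) = {..<p}) \<and>
      (1 - 2 * \<epsilon>) * (\<alpha> * F) \<le> card {s. s < m \<and> hd (\<omega> s) \<in> vacant c \<omega> s} \<and>
      card {s. s < m \<and> hd (\<omega> s) \<in> vacant c \<omega> s} \<le> (1 + 2 * \<epsilon>) * (\<alpha> * F) + 1}"
  have xs: "?xs ! s \<in> G" if "s < m" for s
    using that G(2) fin nth_mem[of s ?xs] by (simp add: set_candidate_order length_candidate_order)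
  have distr: "distr preferences ?P proj = ?P"
    unfolding proj_def
  proof (rule distr_PiM_reindex)
    show "inj_on ((!) ?xs) {..<m}"
      using G(2) by (intro inj_on_nth distinct_candidate_order fin) (auto simp: length_candidate_order)
    show "(!) ?xs \<in> {..<m} \<rightarrow> {..<n}" using xs G(1) by auto
  qed (rule measure_pmf.prob_space_axioms)
  have "proj \<in> preferences \<rightarrow>\<^sub>M ?P"
    by (auto simp: measurable_PiM_measure_pmf space_PiM proj_def)
  moreover have "Good \<in> sets ?P"
    by (auto simp: sets_PiM_measure_pmf Good_def space_PiM)
  ultimately have "measure ?P Good = measure preferences (proj -` Good \<inter> space preferences)"
    by (subst distr[symmetric], subst measure_distr) auto
  also have "\<dots> \<le> measure preferences {\<sigma> \<in> space preferences.
      (1 - 2 * \<epsilon>) * (\<alpha> * F) \<le> f \<sigma> \<and> f \<sigma> \<le> (1 + 2 * \<epsilon>) * (\<alpha> * F) + 1}"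
  proof (rule population.M2.finite_measure_mono_AE)
    show "AE \<sigma> in preferences. \<sigma> \<in> proj -` Good \<inter> space preferences \<longrightarrow>
        \<sigma> \<in> {\<sigma> \<in> space preferences. (1 - 2 * \<epsilon>) * (\<alpha> * F) \<le> f \<sigma> \<and> f \<sigma> \<le> (1 + 2 * \<epsilon>) * (\<alpha> * F) + 1}"
      using AE_ranking
    proof eventually_elim
      case (elim \<sigma>)
      \<comment> \<open>The projection is undefined from \<open>m\<close> on, but vacancy before
        \<open>m\<close> depends only on earlier lists.\<close>
      have "vacant c (proj \<sigma>) s = vacant c (\<lambda>r. \<sigma> (?xs ! r)) s" if "s < m" for s
        using that by (intro vacant_cong) (simp add: proj_def)
      then have "{s. s < m \<and> hd (proj \<sigma> s) \<in> vacant c (proj \<sigma>) s} =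
          {s. s < m \<and> hd (\<sigma> (?xs ! s)) \<in> vacant c (\<lambda>r. \<sigma> (?xs ! r)) s}"
        by (auto simp: proj_def)
      then have "f \<sigma> = card {s. s < m \<and> hd (proj \<sigma> s) \<in> vacant c (proj \<sigma>) s}"
        unfolding f_def m_def using elim G
        by (subst card_first_choice_alg_st[OF fin _ p]) (auto simp: m_def)
      then show ?case by (auto simp: Good_def)
    qed
  qed (auto simp: sets_PiM_measure_pmf space_PiM)
  finally show ?thesis
    using first_choice_concentration[OF set_ranking p t1 t2 t3 alpha eps d pK] m dF
    by (fold m_def F_def Good_def) (auto simp: Good_def)
qed

end

section \<open>The three metrics\<close>

locale proportional_selection = selection_model +
  assumes exact: "\<And>l. l < p \<Longrightarrow> n dvd k l * card G\<^sub>1" "\<And>l. l < p \<Longrightarrow> n dvd k l * card G\<^sub>2"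
    and nonempty: "G\<^sub>1 \<noteq> {}" "G\<^sub>2 \<noteq> {}"
    and capacity_pos: "0 < (\<Sum>l<p. k l)"
begin

definition "slots = (\<Sum>l<p. k l)"

lemma slots: "0 < slots" "slots \<le> n"
  using capacity_pos total_capacity by (simp_all only: slots_def)

definition quota :: "nat set \<Rightarrow> nat \<Rightarrow> nat" where "quota G l = k l * card G div n"

lemma quota: "l < p \<Longrightarrow> G \<in> {G\<^sub>1, G\<^sub>2} \<Longrightarrow> real (quota G l) = card G / n * k l"
  using exact[of l] n_pos by (auto simp: quota_def real_of_nat_div)

lemma sum_quota:
  assumes "G \<in> {G\<^sub>1, G\<^sub>2}"
  shows "real (\<Sum>l<p. quota G l) = slots * card G / n"
proof -
  have "real (\<Sum>l<p. quota G l) = (\<Sum>l<p. card G / n * k l)"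
    unfolding of_nat_sum using assms by (intro sum.cong quota) auto
  then show ?thesis by (simp add: slots_def sum_divide_distrib sum_distrib_left sum_distrib_right mult.commute)
qed

lemma card_groups: "0 < card G\<^sub>1" "0 < card G\<^sub>2" "card G\<^sub>1 < n" "card G\<^sub>2 < n"
proof -
  show pos: "0 < card G\<^sub>1" "0 < card G\<^sub>2" using nonempty groups by (auto simp: card_gt_0_iff)
  with groups(5) show "card G\<^sub>1 < n" "card G\<^sub>2 < n" by linarith+
qed

lemma sum_quota_le:
  assumes "G \<in> {G\<^sub>1, G\<^sub>2}"
  shows "(\<Sum>l<p. quota G l) \<le> card G"
proof -
  have "real slots * card G / n \<le> card G"
    using slots n_pos mult_right_mono[of "real slots" "real n" "real (card G)"]
    by (simp add: pos_divide_le_eq mult.commute)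
  then have "real (\<Sum>l<p. quota G l) \<le> card G"
    using sum_quota[OF assms] by simp
  then show ?thesis by (simp only: of_nat_le_iff)
qed

lemma inst_wise_eq:
  "alg_inst_wise n k G\<^sub>1 G\<^sub>2 v \<sigma> i =
     (if i \<in> G\<^sub>1 then alg_st G\<^sub>1 (quota G\<^sub>1) v \<sigma> i else alg_st G\<^sub>2 (quota G\<^sub>2) v \<sigma> i)"
proof (cases "i \<in> G\<^sub>1")
  case True
  then have "i \<notin> G\<^sub>2" using groups_disjoint by blast
  then show ?thesis
    using True alg_st_outside[OF groups(4), of i] by (simp add: alg_inst_wise_def map_add_def quota_def[abs_def])
next
  case False
  then show ?thesis
    using alg_st_outside[OF groups(3) False]
    by (simp add: alg_inst_wise_def map_add_def quota_def[abs_def] split: option.split)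
qed

definition selected :: "nat set \<Rightarrow> (nat \<Rightarrow> real) \<Rightarrow> nat set" where
  "selected G v = set (take (\<Sum>l<p. quota G l) (candidate_order G v))"

lemma selected:
  assumes "G \<in> {G\<^sub>1, G\<^sub>2}"
  shows "selected G v \<subseteq> G" "card (selected G v) = (\<Sum>l<p. quota G l)"
proof -
  have fin: "finite G" using assms groups by auto
  show "selected G v \<subseteq> G"
    using set_candidate_order[OF fin, of v] by (auto simp: selected_def dest: in_set_takeD)
  show "card (selected G v) = (\<Sum>l<p. quota G l)"
    unfolding selected_def using sum_quota_le[OF assms] distinct_candidate_order[OF fin, of v]
    by (subst distinct_card) (auto simp: length_candidate_order)
qed

lemma assigned_inst_wise:
  assumes "\<forall>i\<in>{..<n}. set (\<sigma> i) = {..<p}"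
  shows "assigned p (alg_inst_wise n k G\<^sub>1 G\<^sub>2 v \<sigma>) = selected G\<^sub>1 v \<union> selected G\<^sub>2 v"
proof -
  have a1: "assigned p (alg_st G\<^sub>1 (quota G\<^sub>1) v \<sigma>) = selected G\<^sub>1 v"
    unfolding selected_def using assms groups by (intro assigned_alg_st) auto
  have a2: "assigned p (alg_st G\<^sub>2 (quota G\<^sub>2) v \<sigma>) = selected G\<^sub>2 v"
    unfolding selected_def using assms groups by (intro assigned_alg_st) auto
  have "i \<in> assigned p (alg_inst_wise n k G\<^sub>1 G\<^sub>2 v \<sigma>) \<longleftrightarrow>
      (if i \<in> G\<^sub>1 then i \<in> selected G\<^sub>1 v else i \<in> selected G\<^sub>2 v)" for i
    unfolding a1[symmetric] a2[symmetric] by (simp add: assigned_def inst_wise_eq)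
  then show ?thesis
    using selected(1)[of G\<^sub>1 v] selected(1)[of G\<^sub>2 v] groups_disjoint
    by (auto split: if_splits)
qed

section \<open>Representation\<close>

text \<open>Group G fills exactly \<open>slots * card G / n\<close> places, so both fractions equal
  \<open>slots / n\<close> for every outcome in which all lists are rankings.\<close>

theorem representation: "representation_metric n p G\<^sub>1 G\<^sub>2 D L \<beta> (alg_inst_wise n k G\<^sub>1 G\<^sub>2) = 1"
proof -
  interpret pop: prob_space "population n D L"
    unfolding population_eq by (rule population.prob_space_axioms)
  define h where "h = (\<lambda>(u, \<sigma>). let M = inst_wise u \<sigma>
      in min_max_ratio (assigned_fraction p M G\<^sub>1) (assigned_fraction p M G\<^sub>2))"
  have "h \<in> borel_measurable (population n D L)"
    unfolding h_def Let_def
    by (rule measurable_inst_wise[where \<Psi> = "\<lambda>M _ _. min_max_ratio (assigned_fraction p M G\<^sub>1) (assigned_fraction p M G\<^sub>2)"]) simp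
  moreover have "AE x in population n D L. h x = 1"
    using AE_population_ranking
  proof eventually_elim
    case (elim x)
    define v where "v = estimated_utility \<beta> G\<^sub>2 (fst x)"
    have frac: "assigned_fraction p (inst_wise (fst x) (snd x)) G = slots / n" if "G \<in> {G\<^sub>1, G\<^sub>2}" for G
    proof -
      have "G \<inter> assigned p (inst_wise (fst x) (snd x)) = selected G v"
        unfolding assigned_inst_wise[OF elim] v_def
        using that selected(1)[of G\<^sub>1 v] selected(1)[of G\<^sub>2 v] groups_disjoint
        by (auto simp: v_def)
      moreover have "0 < card G" using that card_groups by auto
      ultimately show ?thesis
        using sum_quota[OF that] by (simp add: assigned_fraction_def selected(2)[OF that])
    qed
    have "slots / n > 0" using slots n_pos by (simp)
    then show "h x = 1"
      using slots(1) n_pos unfolding h_def by (simp add: frac case_prod_beta min_max_ratio_def)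
  qed
  ultimately have "integral\<^sup>L (population n D L) h = (\<integral>x. 1 \<partial>population n D L)"
    by (intro integral_cong_AE) auto
  then show ?thesis
    by (simp add: representation_metric_def h_def pop.prob_space)
qed

section \<open>Utility\<close>

definition chosen :: "(nat \<Rightarrow> real) \<Rightarrow> nat set" where
  "chosen u = selected G\<^sub>1 (estimated_utility \<beta> G\<^sub>2 u) \<union> selected G\<^sub>2 (estimated_utility \<beta> G\<^sub>2 u)"

lemma chosen: "chosen u \<subseteq> {..<n}" "card (chosen u) = slots"
proof -
  let ?v = "estimated_utility \<beta> G\<^sub>2 u"
  show "chosen u \<subseteq> {..<n}"
    using selected(1)[of G\<^sub>1 ?v] selected(1)[of G\<^sub>2 ?v] groups by (auto simp: chosen_def)
  have "finite (selected G ?v)" for G by (simp add: selected_def)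
  then have "card (chosen u) = card (selected G\<^sub>1 ?v) + card (selected G\<^sub>2 ?v)"
    unfolding chosen_def using selected(1)[of G\<^sub>1 ?v] selected(1)[of G\<^sub>2 ?v] groups_disjoint
    by (intro card_Un_disjoint) auto
  then have "real (card (chosen u)) = slots * card G\<^sub>1 / n + slots * card G\<^sub>2 / n"
    using sum_quota[of G\<^sub>1] sum_quota[of G\<^sub>2] by (simp add: selected(2) flip: of_nat_sum)
  also have "\<dots> = slots * (card G\<^sub>1 + card G\<^sub>2) / n"
    by (simp add: add_divide_distrib distrib_left)
  also have "\<dots> = slots" using groups(5) n_pos by simp
  finally show "card (chosen u) = slots" by (simp only: of_nat_eq_iff)
qed

text \<open>Boundedness gives integrability of the ratio without any moment assumption on
  \<open>D\<close>.\<close>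

lemma utility_ratio_chosen_bounds:
  assumes "\<forall>i\<in>{..<n}. 0 \<le> u i"
  defines "r \<equiv> if optimal_utility n slots u = 0 then 1 else (\<Sum>i\<in>chosen u. u i) / optimal_utility n slots u"
  shows "0 \<le> r" "r \<le> 1"
proof -
  have "min 1 (slots / card (chosen u)) * (\<Sum>i\<in>chosen u. u i) \<le> optimal_utility n slots u"
    unfolding optimal_utility_eq using assms chosen slots by (intro sum_top_ge) auto
  then have le: "(\<Sum>i\<in>chosen u. u i) \<le> optimal_utility n slots u"
    using slots by (simp add: chosen(2))
  have ge: "0 \<le> (\<Sum>i\<in>chosen u. u i)"
    using assms chosen(1)[of u] by (intro sum_nonneg) auto
  show "0 \<le> r" "r \<le> 1"
    using le ge by (auto simp: r_def divide_simps)
qed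

text \<open>I.i.d. utilities are exchangeable, so shuffling them preserves the expected ratio.
  Averaging over all shuffles reduces the claim to an inequality that holds for each fixed vector of
  utilities.\<close>

theorem utility: "1 - 1 / sqrt slots \<le> utility_metric n p slots G\<^sub>2 D L \<beta> (alg_inst_wise n k G\<^sub>1 G\<^sub>2)"
proof -
  interpret pop: prob_space "population n D L"
    unfolding population_eq by (rule population.prob_space_axioms)
  define r where "r u = (if optimal_utility n slots u = 0 then 1
      else (\<Sum>i\<in>chosen u. u i) / optimal_utility n slots u)" for u
  have r: "r \<in> borel_measurable utilities"
  proof -
    have "(\<lambda>u. \<Sum>i\<in>set (take a xs) \<union> set (take b ys). u i) \<in> borel_measurable utilities" for a b xs ys
      by measurable
    from measurable_compose_countable[OF this measurable_order]
    have "(\<lambda>u. \<Sum>i\<in>set (take a xs) \<union> set (take b (candidate_order G\<^sub>2 (estimated_utility \<beta> G\<^sub>2 u))). u i)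
        \<in> borel_measurable utilities" for a b xs .
    from measurable_compose_countable[OF this measurable_order]
    have "(\<lambda>u. \<Sum>i\<in>chosen u. u i) \<in> borel_measurable utilities"
      unfolding chosen_def selected_def .
    then show ?thesis unfolding r_def by measurable
  qed
  have metric: "utility_metric n p slots G\<^sub>2 D L \<beta> (alg_inst_wise n k G\<^sub>1 G\<^sub>2) = integral\<^sup>L utilities r"
  proof -
    define h where "h = (\<lambda>(u, \<sigma>). utility_ratio n p slots u (inst_wise u \<sigma>))"
    have "h \<in> borel_measurable (population n D L)"
      unfolding h_def
    proof (rule measurable_inst_wise[where \<Psi> = "\<lambda>M _ u. utility_ratio n p slots u M"])
      fix M :: "nat \<Rightarrow> nat option"
      show "(\<lambda>u. utility_ratio n p slots u M) \<in> borel_measurable utilities"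
        unfolding utility_ratio_def by measurable
    qed
    moreover have rfst: "(\<lambda>x. r (fst x)) \<in> borel_measurable (population n D L)"
      unfolding population_eq by (rule measurable_compose[OF measurable_fst r])
    moreover have "AE x in population n D L. h x = r (fst x)"
      using AE_population_ranking
      by eventually_elim (simp add: h_def r_def case_prod_beta utility_ratio_def assigned_inst_wise chosen_def)
    ultimately have "integral\<^sup>L (population n D L) h = (\<integral>x. r (fst x) \<partial>population n D L)"
      by (intro integral_cong_AE)
    also have "\<dots> = integral\<^sup>L (distr (population n D L) utilities fst) r"
      using r by (subst integral_distr) (auto simp: population_eq)
    also have "distr (population n D L) utilities fst = utilities"
      unfolding population_eq by (rule population.M2.distr_pair_fst)
    finally show ?thesis by (simp add: utility_metric_def h_def)
  qed
  have r_int: "integrable utilities r"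
  proof (rule population.M1.integrable_const_bound[OF _ r])
    show "AE u in utilities. norm (r u) \<le> 1"
      using AE_nonneg
    proof eventually_elim
      case (elim u)
      from utility_ratio_chosen_bounds[OF elim] show ?case by (simp add: r_def)
    qed
  qed
  let ?perms = "{\<pi>. \<pi> permutes {..<n}}"
  define shuffle where "shuffle \<pi> u = (\<lambda>i\<in>{..<n}. u (\<pi> i))" for \<pi> and u :: "nat \<Rightarrow> real"
  have meas: "shuffle \<pi> \<in> utilities \<rightarrow>\<^sub>M utilities"
    and distr: "distr utilities utilities (shuffle \<pi>) = utilities" if "\<pi> permutes {..<n}" for \<pi>
  proof -
    have img: "\<pi> i < n" if "i < n" for i using permutes_in_image[OF \<open>\<pi> permutes {..<n}\<close>, of i] that by simp
    then show "shuffle \<pi> \<in> utilities \<rightarrow>\<^sub>M utilities"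
      unfolding shuffle_def by (intro measurable_restrict measurable_component_singleton) auto
    show "distr utilities utilities (shuffle \<pi>) = utilities"
      unfolding shuffle_def using img that
      by (intro distr_PiM_reindex[where M = "\<lambda>_. D" and I = "{..<n}"]) (auto intro: permutes_inj_on prob_utilities)
  qed
  have r_shuffle: "integrable utilities (\<lambda>u. r (shuffle \<pi> u))" "(\<integral>u. r (shuffle \<pi> u) \<partial>utilities) = integral\<^sup>L utilities r"
    if "\<pi> permutes {..<n}" for \<pi>
    using integrable_distr[OF meas[OF that]] integral_distr[OF meas[OF that] r] r_int
    by (simp_all add: distr[OF that])
  have pointwise: "(1 - 1 / sqrt slots) * fact n \<le> (\<Sum>\<pi>\<in>?perms. r (shuffle \<pi> u))"
    if nonneg: "\<forall>i\<in>{..<n}. 0 \<le> u i" for u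
  proof (cases "optimal_utility n slots u = 0")
    case True
    have "r (shuffle \<pi> u) = 1" if "\<pi> permutes {..<n}" for \<pi>
      using optimal_utility_permute[OF that, of "shuffle \<pi> u" u slots] True by (simp add: r_def shuffle_def)
    then show ?thesis by (simp add: card_permutations mult_le_cancel_right1)
  next
    case False
    moreover have "0 \<le> optimal_utility n slots u"
      unfolding optimal_utility_eq using nonneg
      by (intro sum_nonneg) (auto simp: candidate_order_def dest!: in_set_takeD)
    ultimately have pos: "0 < optimal_utility n slots u" by simp
    have "(1 - 1 / sqrt slots) * optimal_utility n slots u * fact n \<le>
        (\<Sum>\<pi> | \<pi> permutes {..<n}. \<Sum>i\<in>chosen (shuffle \<pi> u). u (\<pi> i))"
    proof (rule average_group_utility[where v = "\<lambda>\<pi>. estimated_utility \<beta> G\<^sub>2 (shuffle \<pi> u)"])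
      show "real (\<Sum>l<p. quota G\<^sub>1 l) = real (slots * card G\<^sub>1) / n" "real (\<Sum>l<p. quota G\<^sub>2 l) = real (slots * card G\<^sub>2) / n"
        by (simp_all add: sum_quota del: of_nat_sum)
      show "estimated_utility \<beta> G\<^sub>2 (shuffle \<pi> u) i = u (\<pi> i)" if "i \<in> G\<^sub>1" for \<pi> i
        using that groups groups_disjoint by (auto simp: estimated_utility_def shuffle_def)
      show "estimated_utility \<beta> G\<^sub>2 (shuffle \<pi> u) i = \<beta> * u (\<pi> i)" if "i \<in> G\<^sub>2" for \<pi> i
        using that groups by (auto simp: estimated_utility_def shuffle_def)
      show "chosen (shuffle \<pi> u) =
          set (take (\<Sum>l<p. quota G\<^sub>1 l) (candidate_order G\<^sub>1 (estimated_utility \<beta> G\<^sub>2 (shuffle \<pi> u)))) \<union>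
          set (take (\<Sum>l<p. quota G\<^sub>2 l) (candidate_order G\<^sub>2 (estimated_utility \<beta> G\<^sub>2 (shuffle \<pi> u))))" for \<pi>
        by (simp add: chosen_def selected_def)
    qed (use n_pos groups_cover groups_disjoint slots nonneg bias in auto)
    also have "\<dots> = (\<Sum>\<pi> | \<pi> permutes {..<n}. r (shuffle \<pi> u) * optimal_utility n slots u)"
    proof (rule sum.cong[OF refl])
      fix \<pi> assume "\<pi> \<in> ?perms"
      \<comment> \<open>All shuffles share the same optimum, so the averaged ratios have a common
        denominator.\<close>
      then have "optimal_utility n slots (shuffle \<pi> u) = optimal_utility n slots u"
        by (intro optimal_utility_permute) (auto simp: shuffle_def)
      moreover have "(\<Sum>i\<in>chosen (shuffle \<pi> u). u (\<pi> i)) = (\<Sum>i\<in>chosen (shuffle \<pi> u). shuffle \<pi> u i)"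
        using chosen(1)[of "shuffle \<pi> u"] by (intro sum.cong) (auto simp: shuffle_def)
      ultimately show "(\<Sum>i\<in>chosen (shuffle \<pi> u). u (\<pi> i)) = r (shuffle \<pi> u) * optimal_utility n slots u"
        using pos by (simp add: r_def)
    qed
    finally have "(1 - 1 / sqrt slots) * fact n * optimal_utility n slots u \<le>
        (\<Sum>\<pi>\<in>?perms. r (shuffle \<pi> u)) * optimal_utility n slots u"
      unfolding sum_distrib_right by (simp add: mult_ac)
    then show ?thesis using pos by (simp only: mult_le_cancel_right_pos)
  qed
  have "(1 - 1 / sqrt slots) * fact n \<le> (\<integral>u. (\<Sum>\<pi>\<in>?perms. r (shuffle \<pi> u)) \<partial>utilities)"
  proof (rule population.M1.integral_ge_const)
    show "integrable utilities (\<lambda>u. \<Sum>\<pi>\<in>?perms. r (shuffle \<pi> u))"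
      using r_shuffle by (intro Bochner_Integration.integrable_sum) auto
    show "AE u in utilities. (1 - 1 / sqrt slots) * fact n \<le> (\<Sum>\<pi>\<in>?perms. r (shuffle \<pi> u))"
      using AE_nonneg by eventually_elim (rule pointwise)
  qed
  also have "\<dots> = (\<Sum>\<pi>\<in>?perms. integral\<^sup>L utilities r)"
    using r_shuffle by (subst Bochner_Integration.integral_sum) auto
  also have "\<dots> = integral\<^sup>L utilities r * fact n" by (simp add: card_permutations)
  finally show ?thesis unfolding metric by (simp only: mult_le_cancel_right_pos[OF fact_gt_zero])
qed

lemma two_le_slots: "2 \<le> slots"
proof -
  have "\<exists>l<p. k l \<noteq> 0"
    using slots(1) unfolding slots_def by (rule contrapos_pp) simp
  then obtain l where l: "l < p" "k l \<noteq> 0" by blast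
  \<comment> \<open>A single slot cannot be divided exactly between two nonempty groups.\<close>
  have "k l \<noteq> 1"
    using exact(1)[OF l(1)] card_groups dvd_imp_le[of n "card G\<^sub>1"] by auto
  moreover have "k l \<le> slots"
    unfolding slots_def using l(1) by (intro member_le_sum) auto
  ultimately show ?thesis using l(2) by linarith
qed

section \<open>Preference\<close>

text \<open>By Fubini it suffices to fix \<open>u\<close>. Both groups are within their bounds
  around the same \<phi> with probability at least 1 - 2 b; there the ratio is at least 1 - 5
  \<epsilon>, and elsewhere it is nonnegative.\<close>

lemma preference_integral_ge:
  fixes b \<epsilon> \<phi> :: real
  assumes b: "\<And>u G. G \<in> {G\<^sub>1, G\<^sub>2} \<Longrightarrow> 1 - b \<le> measure preferences {\<sigma> \<in> space preferences.
      (1 - 2 * \<epsilon>) * \<phi> \<le> first_choice_fraction \<sigma> (inst_wise u \<sigma>) G \<and>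
      first_choice_fraction \<sigma> (inst_wise u \<sigma>) G \<le> (1 + 3 * \<epsilon>) * \<phi>}"
    and phi: "0 < \<phi>" and eps: "0 \<le> \<epsilon>" "5 * \<epsilon> \<le> 1" and b_nonneg: "0 \<le> b"
  shows "1 - 5 * \<epsilon> - 2 * b \<le> preference_metric n G\<^sub>1 G\<^sub>2 D L \<beta> (alg_inst_wise n k G\<^sub>1 G\<^sub>2)"
proof -
  interpret pop: prob_space "population n D L"
    unfolding population_eq by (rule population.prob_space_axioms)
  let ?q = "\<lambda>u \<sigma> G. first_choice_fraction \<sigma> (inst_wise u \<sigma>) G"
  define h where "h = (\<lambda>(u, \<sigma>). min_max_ratio (?q u \<sigma> G\<^sub>1) (?q u \<sigma> G\<^sub>2))"
  have h_meas: "h \<in> borel_measurable (population n D L)"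
    unfolding h_def
    by (rule measurable_inst_wise[where \<Psi> = "\<lambda>M \<sigma> _. min_max_ratio (first_choice_fraction \<sigma> M G\<^sub>1) (first_choice_fraction \<sigma> M G\<^sub>2)"]) simp
  have h: "0 \<le> h x" "h x \<le> 1" for x
    by (auto simp: h_def case_prod_beta first_choice_fraction_def intro: min_max_ratio_nonneg min_max_ratio_le_1)
  have h_int: "integrable (population n D L) h"
    using h h_meas by (intro pop.integrable_const_bound[of _ 1]) auto
  define Good where "Good u G = {\<sigma> \<in> space preferences. (1 - 2 * \<epsilon>) * \<phi> \<le> ?q u \<sigma> G \<and> ?q u \<sigma> G \<le> (1 + 3 * \<epsilon>) * \<phi>}"
    for u G
  have events: "A \<in> population.M2.events" if "A \<subseteq> space preferences" for A
    using that by (simp add: sets_PiM_measure_pmf space_PiM)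
  have inner: "1 - 5 * \<epsilon> - 2 * b \<le> (\<integral>\<sigma>. h (u, \<sigma>) \<partial>preferences)" for u
  proof -
    have good: "1 - b \<le> measure preferences (Good u G\<^sub>1)" "1 - b \<le> measure preferences (Good u G\<^sub>2)"
      unfolding Good_def using b by auto
    have ev: "Good u G \<in> population.M2.events" for G by (rule events) (auto simp: Good_def)
    let ?A = "Good u G\<^sub>1 \<inter> Good u G\<^sub>2"
    have "measure preferences (Good u G\<^sub>1 \<union> Good u G\<^sub>2) \<le> 1"
      by (rule population.M2.prob_le_1)
    moreover have "measure preferences (Good u G\<^sub>1 \<union> Good u G\<^sub>2) =
        measure preferences (Good u G\<^sub>1) + measure preferences (Good u G\<^sub>2) - measure preferences ?A"
      using ev by (intro measure_Un3) (auto simp: fmeasurable_def population.M2.emeasure_finite less_top[symmetric])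
    ultimately have "1 - 2 * b \<le> measure preferences ?A"
      using good by linarith
    then have "(1 - 5 * \<epsilon>) * (1 - 2 * b) \<le> (1 - 5 * \<epsilon>) * measure preferences ?A"
      using eps by (intro mult_left_mono) auto
    moreover have "1 - 5 * \<epsilon> - 2 * b \<le> (1 - 5 * \<epsilon>) * (1 - 2 * b)"
      using eps b_nonneg by (simp add: algebra_simps)
    moreover have "(1 - 5 * \<epsilon>) * measure preferences ?A = (\<integral>\<sigma>. (1 - 5 * \<epsilon>) * indicator ?A \<sigma> \<partial>preferences)"
      using ev sets.sets_into_space[OF ev] by (simp add: Int_absorb2 Int_assoc)
    moreover have "\<dots> \<le> (\<integral>\<sigma>. h (u, \<sigma>) \<partial>preferences)"
    proof (rule integral_mono)
      show "integrable preferences (\<lambda>\<sigma>. (1 - 5 * \<epsilon>) * indicator ?A \<sigma>)"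
        using ev by (intro integrable_mult_right integrable_real_indicator)
          (auto simp: population.M2.emeasure_finite less_top[symmetric])
      show "integrable preferences (\<lambda>\<sigma>. h (u, \<sigma>))"
        using h by (intro population.M2.integrable_const_bound[of _ 1])
          (auto simp: measurable_PiM_measure_pmf)
      fix \<sigma>
      show "(1 - 5 * \<epsilon>) * indicator ?A \<sigma> \<le> h (u, \<sigma>)"
      proof (cases "\<sigma> \<in> ?A")
        case True
        then show ?thesis
          using phi eps by (auto simp: Good_def h_def intro!: min_max_ratio_ge)
      next
        case False
        then show ?thesis using h(1)[of "(u, \<sigma>)"] by simp
      qed
    qed
    ultimately show ?thesis by linarith
  qed
  have "1 - 5 * \<epsilon> - 2 * b \<le> (\<integral>u. \<integral>\<sigma>. h (u, \<sigma>) \<partial>preferences \<partial>utilities)"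
    using h_int inner unfolding population_eq
    by (intro population.M1.integral_ge_const population.integrable_fst') auto
  also have "\<dots> = integral\<^sup>L (population n D L) h"
    using h_int unfolding population_eq by (rule population.integral_fst')
  finally show ?thesis by (simp add: preference_metric_def h_def Let_def)
qed

text \<open>With \<open>Err\<close> as below, 5 \<epsilon> costs at most 40 \<open>Err\<close>, and
  2 b costs at most 8 p / K, hence 16 \<open>Err\<close>. The sum 56 is rounded up to 60.\<close>

theorem preference:
  fixes \<eta>\<^sub>1 \<eta>\<^sub>3 :: real
  assumes eta: "0 < \<eta>\<^sub>1" "0 < \<eta>\<^sub>3"
    and groups_large: "\<eta>\<^sub>1 * n \<le> card G\<^sub>1" "\<eta>\<^sub>1 * n \<le> card G\<^sub>2"
    and capacities_large: "\<And>l. l < p \<Longrightarrow> \<eta>\<^sub>3 * slots \<le> k l"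
  shows "1 - 60 * (p * sqrt (ln slots) / (\<eta>\<^sub>1 * \<eta>\<^sub>3 * sqrt slots)) \<le>
    preference_metric n G\<^sub>1 G\<^sub>2 D L \<beta> (alg_inst_wise n k G\<^sub>1 G\<^sub>2)"
proof -
  have K2: "2 \<le> real slots" using two_le_slots by simp
  have p: "0 < p" using slots(1) unfolding slots_def by (cases "p = 0") auto
  have eta1: "\<eta>\<^sub>1 \<le> 1"
  proof -
    have "real (card G\<^sub>1) \<le> n" using card_groups(3) by simp
    with groups_large(1) have "\<eta>\<^sub>1 * n \<le> n" by linarith
    then show ?thesis using n_pos by (simp add: mult_le_cancel_right2)
  qed
  have p_eta: "p * \<eta>\<^sub>3 \<le> 1"
  proof -
    have "p * (\<eta>\<^sub>3 * slots) = (\<Sum>l<p. \<eta>\<^sub>3 * slots)" by simp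
    also have "\<dots> \<le> (\<Sum>l<p. real (k l))" using capacities_large by (intro sum_mono) auto
    also have "\<dots> = slots" by (simp add: slots_def)
    finally show ?thesis using slots(1) by (simp add: mult.assoc[symmetric] mult_le_cancel_right2)
  qed
  have ln_pos: "0 \<le> ln slots" using K2 by simp
  have sqrt_ln: "1 / 2 \<le> sqrt (ln slots)"
  proof -
    have "1 / 4 \<le> ln (2 :: real)" using ln2_ge_two_thirds by simp
    also have "\<dots> \<le> ln slots" using K2 by simp
    finally have "sqrt (1 / 4) \<le> sqrt (ln slots)" by (rule real_sqrt_le_mono)
    then show ?thesis by (simp add: real_sqrt_divide)
  qed
  \<comment> \<open>The constant 8 makes the deviation \<open>d\<close> below at least 2 when only
    sqrt (ln K) \<ge> 1 / 2 is known; the exponent in Hoeffding's bound then has room to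
    spare.\<close>
  define \<epsilon> where "\<epsilon> = 8 * sqrt (ln slots) / (\<eta>\<^sub>3 * sqrt (\<eta>\<^sub>1 * slots))"
  define Err where "Err = p * sqrt (ln slots) / (\<eta>\<^sub>1 * \<eta>\<^sub>3 * sqrt slots)"
  have eps: "0 < \<epsilon>" using sqrt_ln eta K2 by (auto simp: \<epsilon>_def)
  have root: "0 < sqrt (\<eta>\<^sub>1 * slots)" using eta K2 by simp
  have "1 * \<eta>\<^sub>3 \<le> real p * \<eta>\<^sub>3" using p eta by (intro mult_right_mono) auto
  with p_eta have eta3: "\<eta>\<^sub>3 \<le> 1" by linarith
  have sqrtK: "1 \<le> sqrt slots" "sqrt slots \<le> slots"
    using K2 by (auto intro: real_le_lsqrt simp: power2_eq_square)
  have eps_Err: "\<epsilon> \<le> 8 * Err"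
  proof -
    have "(\<eta>\<^sub>1 * sqrt slots)\<^sup>2 = \<eta>\<^sub>1\<^sup>2 * slots" by (simp add: power_mult_distrib)
    also have "\<dots> = \<eta>\<^sub>1 * (\<eta>\<^sub>1 * slots)" by (simp add: power2_eq_square)
    also have "\<dots> \<le> 1 * (\<eta>\<^sub>1 * slots)" using eta eta1 by (intro mult_right_mono) auto
    finally have "(\<eta>\<^sub>1 * sqrt slots)\<^sup>2 \<le> \<eta>\<^sub>1 * slots" by simp
    then have le: "\<eta>\<^sub>1 * sqrt slots \<le> sqrt (\<eta>\<^sub>1 * slots)" by (rule real_le_rsqrt)
    have "\<epsilon> \<le> 8 * (real p * sqrt (ln slots)) / (\<eta>\<^sub>3 * (\<eta>\<^sub>1 * sqrt slots))"
      unfolding \<epsilon>_def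
    proof (rule frac_le)
      have "1 * sqrt (ln slots) \<le> real p * sqrt (ln slots)"
        using p ln_pos by (intro mult_right_mono) auto
      then show "8 * sqrt (ln slots) \<le> 8 * (real p * sqrt (ln slots))" by simp
    qed (use le eta K2 ln_pos in auto)
    then show ?thesis by (simp add: Err_def mult_ac)
  qed
  \<comment> \<open>Capacities of at least \<open>\<eta>\<^sub>3 * slots\<close> leave room for at
    most \<open>1 / \<eta>\<^sub>3\<close> institutions, and \<epsilon> K exceeds that number
    because \<open>sqrt (\<eta>\<^sub>1 * slots)\<close> is at most K.\<close>
  have pK: "real p \<le> \<epsilon> * real slots"
  proof -
    have "\<eta>\<^sub>1 * slots \<le> 1 * real slots" using eta1 by (intro mult_right_mono) auto
    then have "sqrt (\<eta>\<^sub>1 * slots) \<le> sqrt slots" by simp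
    then have "sqrt (\<eta>\<^sub>1 * slots) \<le> slots" using sqrtK(2) by linarith
    then have "1 \<le> slots / sqrt (\<eta>\<^sub>1 * slots)" using root by (simp add: pos_le_divide_eq)
    moreover have "1 \<le> 8 * sqrt (ln slots)" using sqrt_ln by simp
    ultimately have "1 * 1 \<le> 8 * sqrt (ln slots) * (slots / sqrt (\<eta>\<^sub>1 * slots))"
      using ln_pos by (intro mult_mono) auto
    then have "p * \<eta>\<^sub>3 \<le> 8 * sqrt (ln slots) * (slots / sqrt (\<eta>\<^sub>1 * slots))" using p_eta by linarith
    then have "real p \<le> 8 * sqrt (ln slots) * (slots / sqrt (\<eta>\<^sub>1 * slots)) / \<eta>\<^sub>3"
      using eta(2) by (simp only: pos_le_divide_eq)
    also have "\<dots> = \<epsilon> * slots" by (simp add: \<epsilon>_def)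
    finally show ?thesis .
  qed
  have invK: "p / slots \<le> 2 * Err"
  proof -
    have "\<eta>\<^sub>1 * \<eta>\<^sub>3 * sqrt slots \<le> 1 * 1 * real slots"
      using eta eta1 eta3 sqrtK by (intro mult_mono) auto
    then have "real p * 1 / slots \<le> real p * (2 * sqrt (ln slots)) / (\<eta>\<^sub>1 * \<eta>\<^sub>3 * sqrt slots)"
      using eta K2 sqrt_ln ln_pos by (intro frac_le mult_left_mono) auto
    then show ?thesis by (simp add: Err_def mult_ac)
  qed
  show ?thesis
  proof (cases "5 * \<epsilon> \<le> 1")
    \<comment> \<open>A large \<epsilon> makes 40 \<open>Err\<close> exceed 1, and the claimed bound
      is negative.\<close>
    case False
    have "0 \<le> preference_metric n G\<^sub>1 G\<^sub>2 D L \<beta> (alg_inst_wise n k G\<^sub>1 G\<^sub>2)"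
      unfolding preference_metric_def
      by (intro integral_nonneg_AE AE_I2)
        (auto simp: case_prod_beta Let_def first_choice_fraction_def intro!: min_max_ratio_nonneg)
    with False eps_Err show ?thesis unfolding Err_def[symmetric] by linarith
  next
    case True
    obtain t where t: "\<And>l. l < p \<Longrightarrow> real (k l) \<le> (\<Sum>s<t l. share L (alive t p s) l)"
      "\<And>l. l < p \<Longrightarrow> (\<Sum>s<t l. share L (alive t p s) l) \<le> real (k l) + 1"
      "\<And>l. l < p \<Longrightarrow> t l \<le> (\<Sum>l<p. k l) + p"
      using fluid_times[OF set_ranking, where k = k] by blast
    define F where "F = (\<Sum>l<p. measure_pmf.prob L {w. hd w = l} * real (t l))"
    \<comment> \<open>An institution receives at most 1 per step, so it stays open for at least
      \<open>k l\<close> steps; \<open>F\<close> is a weighted mean of these times.\<close>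
    have F: "\<eta>\<^sub>3 * slots \<le> F"
    proof -
      have t_ge: "\<eta>\<^sub>3 * slots \<le> t l" if "l < p" for l
      proof -
        have "\<eta>\<^sub>3 * slots \<le> (\<Sum>s<t l. share L (alive t p s) l)"
          using capacities_large[OF that] t(1)[OF that] by linarith
        also have "\<dots> \<le> (\<Sum>s<t l. 1)" by (intro sum_mono share_le_1)
        finally show ?thesis by simp
      qed
      have "\<eta>\<^sub>3 * slots = (\<Sum>l<p. measure_pmf.prob L {w. hd w = l}) * (\<eta>\<^sub>3 * slots)"
        by (simp add: sum_prob_hd[OF set_ranking p])
      also have "\<dots> \<le> F"
        unfolding F_def sum_distrib_right by (intro sum_mono mult_left_mono t_ge) auto
      finally show ?thesis .
    qed
    define b where "b = (2 * real p + 2) / slots"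
    have "1 - 5 * \<epsilon> - 2 * b \<le> preference_metric n G\<^sub>1 G\<^sub>2 D L \<beta> (alg_inst_wise n k G\<^sub>1 G\<^sub>2)"
    proof (rule preference_integral_ge[where \<phi> = "F / n"])
      have "0 < \<eta>\<^sub>3 * slots" using eta slots by simp
      with F have "0 < F" by linarith
      then show "0 < F / n" using n_pos by simp
      fix u G assume G: "G \<in> {G\<^sub>1, G\<^sub>2}"
      define \<alpha> where "\<alpha> = card G / n"
      have cardG: "0 < card G" "card G < n" "\<eta>\<^sub>1 * n \<le> card G" "G \<subseteq> {..<n}"
        using G card_groups groups_large groups by auto
      then have alpha: "0 < \<alpha>" "\<alpha> \<le> 1" "\<eta>\<^sub>1 \<le> \<alpha>"
        using n_pos by (auto simp: \<alpha>_def field_simps)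
      define m where "m = (\<Sum>l<p. quota G l)"
      have m: "real m = \<alpha> * slots"
        using sum_quota[OF G] by (simp add: m_def \<alpha>_def mult.commute del: of_nat_sum)
      then have "0 < m" using alpha slots by (metis mult_pos_pos of_nat_0_less_iff)
      \<comment> \<open>Half of the margin \<epsilon> c that every quota c offers; as
        \<open>d\<close> is at least 2, the other half covers the rounding loss of 2.\<close>
      define d where "d = \<epsilon> * \<eta>\<^sub>3 * m / 2"
      have etaK_m: "\<eta>\<^sub>1 * slots \<le> m" unfolding m using alpha by (intro mult_right_mono) auto
      have d_eq: "d = 4 * sqrt (ln slots) * (m / sqrt (\<eta>\<^sub>1 * slots))"
        using eta by (simp add: d_def \<epsilon>_def)
      have d2: "2 \<le> d"
      proof -
        have "sqrt (\<eta>\<^sub>1 * slots) \<le> sqrt m" using etaK_m by simp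
        also have "\<dots> \<le> m" using \<open>0 < m\<close> by (auto intro: real_le_lsqrt simp: power2_eq_square)
        finally have "1 \<le> m / sqrt (\<eta>\<^sub>1 * slots)" using root by (simp add: pos_le_divide_eq)
        then have "2 * 1 \<le> 4 * sqrt (ln slots) * (m / sqrt (\<eta>\<^sub>1 * slots))"
          using sqrt_ln ln_pos by (intro mult_mono) auto
        then show ?thesis by (simp add: d_eq)
      qed
      have exp_d: "exp (- 2 * d\<^sup>2 / m) \<le> 1 / slots"
      proof -
        have "d\<^sup>2 = 16 * ln slots * (m\<^sup>2 / (\<eta>\<^sub>1 * slots))"
          using eta ln_pos by (simp add: d_eq power_mult_distrib power_divide)
        then have "2 * d\<^sup>2 / m = 32 * ln slots * (m / (\<eta>\<^sub>1 * slots))"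
          using \<open>0 < m\<close> by (simp add: power2_eq_square)
        moreover have "1 \<le> m / (\<eta>\<^sub>1 * slots)"
          using etaK_m eta K2 by (simp add: pos_le_divide_eq)
        then have "ln slots * 1 \<le> 32 * ln slots * (m / (\<eta>\<^sub>1 * slots))"
          using ln_pos by (intro mult_mono) auto
        ultimately have "exp (- 2 * d\<^sup>2 / m) \<le> exp (- ln slots)" by simp
        also have "\<dots> = 1 / slots" using K2 by (simp add: exp_minus inverse_eq_divide)
        finally show ?thesis .
      qed
      have cl: "2 * d \<le> \<epsilon> * quota G l" if "l < p" for l
      proof -
        have "\<eta>\<^sub>3 * m \<le> quota G l"
          using mult_left_mono[OF capacities_large[OF that], of \<alpha>] alpha quota[OF that G]
          by (simp add: m \<alpha>_def mult_ac)
        then show ?thesis using eps by (simp add: d_def mult.assoc)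
      qed
      have dF: "2 * d \<le> \<epsilon> * (\<alpha> * F)"
        using mult_left_mono[OF mult_left_mono[OF F, of \<alpha>], of \<epsilon>] alpha eps
        by (simp add: d_def m mult_ac)
      define f where "f \<sigma> = real (card {i \<in> G. alg_st G (quota G) (estimated_utility \<beta> G\<^sub>2 u) \<sigma> i = Some (hd (\<sigma> i))})" for \<sigma>
      have "1 - (2 * real p + 2) * exp (- 2 * d\<^sup>2 / m) \<le> measure preferences {\<sigma> \<in> space preferences.
          (1 - 2 * \<epsilon>) * (\<alpha> * F) \<le> f \<sigma> \<and> f \<sigma> \<le> (1 + 2 * \<epsilon>) * (\<alpha> * F) + 1}"
        unfolding f_def F_def m_def
      proof (rule group_first_choice[OF p t alpha(1,2)])
        show "real (quota G l) = \<alpha> * real (k l)" if "l < p" for l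
          using quota[OF that G] by (simp add: \<alpha>_def)
        show "d + 2 \<le> \<epsilon> * real (quota G l)" if "l < p" for l
          using cl[OF that] d2 by linarith
        show "d \<le> \<epsilon> * (\<alpha> * (\<Sum>l<p. measure_pmf.prob L {w. hd w = l} * real (t l)))"
          using dF d2 unfolding F_def by linarith
        show "real p \<le> \<epsilon> * real (\<Sum>l<p. k l)" using pK by (simp only: slots_def)
        show "(\<Sum>l<p. quota G l) \<le> card G" by (rule sum_quota_le[OF G])
        show "0 < (\<Sum>l<p. quota G l)" using \<open>0 < m\<close> by (simp only: m_def)
      qed (use eps True d2 cardG in auto)
      also have "\<dots> \<le> measure preferences {\<sigma> \<in> space preferences.
          (1 - 2 * \<epsilon>) * (F / n) \<le> first_choice_fraction \<sigma> (inst_wise u \<sigma>) G \<and>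
          first_choice_fraction \<sigma> (inst_wise u \<sigma>) G \<le> (1 + 3 * \<epsilon>) * (F / n)}"
      proof (rule population.M2.finite_measure_mono)
        have frac: "first_choice_fraction \<sigma> (inst_wise u \<sigma>) G = f \<sigma> / card G" for \<sigma>
        proof -
          have "inst_wise u \<sigma> i = alg_st G (quota G) (estimated_utility \<beta> G\<^sub>2 u) \<sigma> i" if "i \<in> G" for i
            using that G groups_disjoint by (auto simp: inst_wise_eq)
          then have "{i \<in> G. inst_wise u \<sigma> i = Some (hd (\<sigma> i))} =
              {i \<in> G. alg_st G (quota G) (estimated_utility \<beta> G\<^sub>2 u) \<sigma> i = Some (hd (\<sigma> i))}"
            by auto
          then show ?thesis by (simp add: first_choice_fraction_def f_def)
        qed
        \<comment> \<open>The group size cancels here: both groups are compared with the same value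
          \<open>F / n\<close>.\<close>
        have "\<alpha> * F / card G = F / n" using cardG by (simp add: \<alpha>_def)
        moreover have "x * (\<alpha> * F) / card G = x * (\<alpha> * F / card G)" for x by simp
        ultimately have scale: "x * (\<alpha> * F) / card G = x * (F / n)" for x by simp
        \<comment> \<open>The leftover 1 is absorbed into a third multiple of \<epsilon>, since
          \<epsilon> \<alpha> F is at least 2 d.\<close>
        have upper: "(1 + 2 * \<epsilon>) * (\<alpha> * F) + 1 \<le> (1 + 3 * \<epsilon>) * (\<alpha> * F)"
          using dF d2 by (simp add: algebra_simps)
        show "{\<sigma> \<in> space preferences. (1 - 2 * \<epsilon>) * (\<alpha> * F) \<le> f \<sigma> \<and> f \<sigma> \<le> (1 + 2 * \<epsilon>) * (\<alpha> * F) + 1} \<subseteq>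
            {\<sigma> \<in> space preferences.
              (1 - 2 * \<epsilon>) * (F / n) \<le> first_choice_fraction \<sigma> (inst_wise u \<sigma>) G \<and>
              first_choice_fraction \<sigma> (inst_wise u \<sigma>) G \<le> (1 + 3 * \<epsilon>) * (F / n)}"
          unfolding frac scale[symmetric] using upper cardG(1)
          by (auto intro!: divide_right_mono)
      qed (auto simp: sets_PiM_measure_pmf space_PiM)
      finally have "1 - (2 * real p + 2) * exp (- 2 * d\<^sup>2 / m) \<le> measure preferences {\<sigma> \<in> space preferences.
          (1 - 2 * \<epsilon>) * (F / n) \<le> first_choice_fraction \<sigma> (inst_wise u \<sigma>) G \<and>
          first_choice_fraction \<sigma> (inst_wise u \<sigma>) G \<le> (1 + 3 * \<epsilon>) * (F / n)}" .
      moreover have "(2 * real p + 2) * exp (- 2 * d\<^sup>2 / m) \<le> b"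
        using mult_left_mono[OF exp_d, of "2 * real p + 2"] by (simp add: b_def)
      ultimately show "1 - b \<le> measure preferences {\<sigma> \<in> space preferences.
          (1 - 2 * \<epsilon>) * (F / n) \<le> first_choice_fraction \<sigma> (inst_wise u \<sigma>) G \<and>
          first_choice_fraction \<sigma> (inst_wise u \<sigma>) G \<le> (1 + 3 * \<epsilon>) * (F / n)}"
        by linarith
    qed (use eps True in \<open>auto simp: b_def\<close>)
    moreover have "b \<le> 4 * (p / slots)"
      using p by (simp add: b_def divide_right_mono)
    ultimately show ?thesis
      using eps eps_Err invK unfolding Err_def[symmetric] by linarith
  qed
qed

end

theorem theorem2:
  "\<exists>C>0. \<forall>(n::nat) (p::nat) (k::nat \<Rightarrow> nat) (G\<^sub>1::nat set) (G\<^sub>2::nat set)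
      (D::real measure) (L::nat list pmf) (\<beta>::real) (\<eta>\<^sub>1::real) (\<eta>\<^sub>2::real) (\<eta>\<^sub>3::real) (K::nat).
     selection_model n p k G\<^sub>1 G\<^sub>2 D L \<beta> \<and> K = (\<Sum>l<p. k l) \<and>
     (\<forall>l<p. n dvd k l * card G\<^sub>1 \<and> n dvd k l * card G\<^sub>2) \<and>
     0 < \<eta>\<^sub>1 \<and> 0 < \<eta>\<^sub>2 \<and> 0 < \<eta>\<^sub>3 \<and>
     \<eta>\<^sub>1 * real n \<le> real (card G\<^sub>1) \<and> \<eta>\<^sub>1 * real n \<le> real (card G\<^sub>2) \<and>
     \<eta>\<^sub>2 * real n \<le> real K \<and> (\<forall>l<p. \<eta>\<^sub>3 * real K \<le> real (k l))
     \<longrightarrow>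
     preference_metric n G\<^sub>1 G\<^sub>2 D L \<beta> (alg_inst_wise n k G\<^sub>1 G\<^sub>2)
       \<ge> 1 - C * (real p * sqrt (ln (real K)) / (\<eta>\<^sub>1 * \<eta>\<^sub>3 * sqrt (real K))) \<and>
     utility_metric n p K G\<^sub>2 D L \<beta> (alg_inst_wise n k G\<^sub>1 G\<^sub>2)
       \<ge> 1 - C * (sqrt (ln (real n)) / sqrt (\<eta>\<^sub>2 * real n)) \<and>
     representation_metric n p G\<^sub>1 G\<^sub>2 D L \<beta> (alg_inst_wise n k G\<^sub>1 G\<^sub>2) = 1"
\<comment> \<open>The preference bound dictates 60; the utility bound is 1 / sqrt K and only needs
  60 sqrt (ln n) \<ge> 1.\<close>
proof (intro exI[of _ "60 :: real"] conjI allI impI)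
  fix n p :: nat and k :: "nat \<Rightarrow> nat" and G\<^sub>1 G\<^sub>2 :: "nat set" and D :: "real measure"
    and L :: "nat list pmf" and \<beta> \<eta>\<^sub>1 \<eta>\<^sub>2 \<eta>\<^sub>3 :: real and K :: nat
  assume "selection_model n p k G\<^sub>1 G\<^sub>2 D L \<beta> \<and> K = (\<Sum>l<p. k l) \<and>
     (\<forall>l<p. n dvd k l * card G\<^sub>1 \<and> n dvd k l * card G\<^sub>2) \<and>
     0 < \<eta>\<^sub>1 \<and> 0 < \<eta>\<^sub>2 \<and> 0 < \<eta>\<^sub>3 \<and>
     \<eta>\<^sub>1 * real n \<le> real (card G\<^sub>1) \<and> \<eta>\<^sub>1 * real n \<le> real (card G\<^sub>2) \<and>
     \<eta>\<^sub>2 * real n \<le> real K \<and> (\<forall>l<p. \<eta>\<^sub>3 * real K \<le> real (k l))"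
  then have model: "selection_model n p k G\<^sub>1 G\<^sub>2 D L \<beta>" and K_def: "K = (\<Sum>l<p. k l)"
    and exact: "\<And>l. l < p \<Longrightarrow> n dvd k l * card G\<^sub>1" "\<And>l. l < p \<Longrightarrow> n dvd k l * card G\<^sub>2"
    and eta: "0 < \<eta>\<^sub>1" "0 < \<eta>\<^sub>2" "0 < \<eta>\<^sub>3"
    and large: "\<eta>\<^sub>1 * real n \<le> real (card G\<^sub>1)" "\<eta>\<^sub>1 * real n \<le> real (card G\<^sub>2)"
      "\<eta>\<^sub>2 * real n \<le> real K" "\<And>l. l < p \<Longrightarrow> \<eta>\<^sub>3 * real K \<le> real (k l)"
    by blast+
  interpret selection_model n p k G\<^sub>1 G\<^sub>2 D L \<beta> by (rule model)
  have "0 < \<eta>\<^sub>1 * real n" "0 < \<eta>\<^sub>2 * real n" using eta n_pos by simp_all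
  with large have pos: "0 < real (card G\<^sub>1)" "0 < real (card G\<^sub>2)" "0 < real K" by linarith+
  interpret proportional_selection n p k G\<^sub>1 G\<^sub>2 D L \<beta>
  proof
    show "G\<^sub>1 \<noteq> {}" "G\<^sub>2 \<noteq> {}" using pos by auto
    show "0 < (\<Sum>l<p. k l)" using pos(3) unfolding K_def by (simp only: of_nat_0_less_iff)
  qed (rule exact; assumption)+
  have K_eq: "slots = K" unfolding slots_def K_def ..
  show "preference_metric n G\<^sub>1 G\<^sub>2 D L \<beta> (alg_inst_wise n k G\<^sub>1 G\<^sub>2)
       \<ge> 1 - 60 * (real p * sqrt (ln (real K)) / (\<eta>\<^sub>1 * \<eta>\<^sub>3 * sqrt (real K)))"
    using large by (intro preference[unfolded K_eq] eta) auto
  show "representation_metric n p G\<^sub>1 G\<^sub>2 D L \<beta> (alg_inst_wise n k G\<^sub>1 G\<^sub>2) = 1"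
    by (rule representation)
  have n2: "2 \<le> real n" using two_le_slots slots(2) by simp
  have "1 / 4 \<le> ln (2 :: real)" using ln2_ge_two_thirds by simp
  also have "\<dots> \<le> ln n" using n2 by simp
  finally have "sqrt (1 / 4) \<le> sqrt (ln n)" by (rule real_sqrt_le_mono)
  then have "1 \<le> 60 * sqrt (ln n)" by (simp add: real_sqrt_divide)
  moreover have "sqrt (\<eta>\<^sub>2 * n) \<le> sqrt K" using large(3) by simp
  ultimately have "1 / sqrt K \<le> 60 * sqrt (ln n) / sqrt (\<eta>\<^sub>2 * n)"
    using \<open>0 < \<eta>\<^sub>2 * real n\<close> n2 by (intro frac_le) auto
  then show "utility_metric n p K G\<^sub>2 D L \<beta> (alg_inst_wise n k G\<^sub>1 G\<^sub>2)
       \<ge> 1 - 60 * (sqrt (ln (real n)) / sqrt (\<eta>\<^sub>2 * real n))"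
    using utility unfolding K_eq by simp
qed simp

end
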